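(* Let $p\in[1,2)$ and $r_p:=\frac{2p}{2+p}$. For each $n\in\mathbb{N}$ let $X^{(n,p)}$ be uniformly distributed on the unit $\ell^p$ ball $\mathbb{B}_{n,p}$ of $\mathbb{R}^n$, let $\Theta^{(n)}$ be independent of $X^{(n,p)}$ and distributed according to the rotationally invariant probability measure on the unit sphere $\mathbb{S}^{n-1}\subset\mathbb{R}^n$, and set $$W^{(n,p)} := \frac{n^{1/p}}{n^{1/2}}\sum_{i=1}^n X^{(n,p)}_i\,\Theta^{(n)}_i .$$ Then the sequence $(W^{(n,p)})_{n\in\mathbb{N}}$ satisfies a large deviation principle with speed $n^{r_p}$ and the quasiconvex, symmetric, good rate function $\mathbb{I}^{\mathsf{an}}_p(w):=\frac{1}{r_p}|w|^{r_p}$, $w\in\mathbb{R}$.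
   Context: $\mathbb{B}_{n,p}=\{x\in\mathbb{R}^n:\sum_{i=1}^n|x_i|^p\le 1\}$. Large deviation principle (LDP): a sequence $(\xi_n)$ of random variables in a topological space $\Sigma$ satisfies an LDP with speed $s(n)$ and rate function $I:\Sigma\to[0,\infty]$ if $I$ is lower semi-continuous and for all Borel $\Gamma\subset\Sigma$, $-\inf_{\Gamma^\circ}I\le\liminf_n\frac{1}{s(n)}\log\mathbb{P}(\xi_n\in\Gamma^\circ)\le\limsup_n\frac1{s(n)}\log\mathbb{P}(\xi_n\in\bar\Gamma)\le-\inf_{\bar\Gamma}I$. $I$ is good if its level sets $\{I\le c\}$ are compact. A function $f:\mathbb{R}\to(-\infty,\infty]$ is quasiconvex if $\{f\le c\}$ is convex for all $c\in\mathbb{R}$, and symmetric if $f(-w)=f(w)$. *)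

theory Defs
  imports "HOL-Probability.Probability"
begin

text \<open>
  Since the dimension \<open>n\<close> runs through a sequence, \<open>\<real>\<^sup>n\<close> is the space of extensional
  functions \<open>nat \<Rightarrow> real\<close> on the index set \<open>{1..n}\<close>, with the product \<open>\<sigma>\<close>-algebra of
  \<open>PiM\<close>, which is the Borel \<open>\<sigma>\<close>-algebra of \<open>\<real>\<^sup>n\<close>.
\<close>

abbreviation borel_Rn :: "nat \<Rightarrow> (nat \<Rightarrow> real) measure" where
  "borel_Rn n \<equiv> PiM {1..n} (\<lambda>_. borel)"

abbreviation lebesgue_Rn :: "nat \<Rightarrow> (nat \<Rightarrow> real) measure" where
  "lebesgue_Rn n \<equiv> PiM {1..n} (\<lambda>_. lborel)"

definition lp_ball :: "nat \<Rightarrow> real \<Rightarrow> (nat \<Rightarrow> real) set" where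
  "lp_ball n p = {x \<in> space (borel_Rn n). (\<Sum>i=1..n. \<bar>x i\<bar> powr p) \<le> 1}"

definition unit_sphere :: "nat \<Rightarrow> (nat \<Rightarrow> real) set" where
  "unit_sphere n = {x \<in> space (borel_Rn n). (\<Sum>i=1..n. (x i)\<^sup>2) = 1}"

definition orthogonal_mat :: "nat \<Rightarrow> (nat \<Rightarrow> nat \<Rightarrow> real) \<Rightarrow> bool" where
  "orthogonal_mat n A \<longleftrightarrow>
     (\<forall>i\<in>{1..n}. \<forall>j\<in>{1..n}. (\<Sum>k=1..n. A k i * A k j) = (if i = j then 1 else 0))"

definition mat_apply :: "nat \<Rightarrow> (nat \<Rightarrow> nat \<Rightarrow> real) \<Rightarrow> (nat \<Rightarrow> real) \<Rightarrow> (nat \<Rightarrow> real)" where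
  "mat_apply n A x = (\<lambda>i\<in>{1..n}. \<Sum>j=1..n. A i j * x j)"

text \<open>
  Rotational invariance means invariance under the full orthogonal group \<open>O(n)\<close>. For \<open>n \<ge> 2\<close>
  this determines the same measure on the sphere as invariance under \<open>SO(n)\<close>; for \<open>n = 1\<close>,
  where \<open>SO(1)\<close> is trivial, it singles out the uniform measure on \<open>{-1, 1}\<close>.
\<close>

definition rotation_invariant_sphere_prob :: "nat \<Rightarrow> (nat \<Rightarrow> real) measure \<Rightarrow> bool" where
  "rotation_invariant_sphere_prob n \<sigma> \<longleftrightarrow>
     prob_space \<sigma> \<and> sets \<sigma> = sets (borel_Rn n) \<and> emeasure \<sigma> (unit_sphere n) = 1 \<and>
     (\<forall>A. orthogonal_mat n A \<longrightarrow> distr \<sigma> (borel_Rn n) (mat_apply n A) = \<sigma>)"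

text \<open>Logarithm of a probability, with \<open>log 0 = -\<infinity>\<close> (whereas \<open>ln 0 = 0\<close> on the reals).\<close>

definition elog :: "real \<Rightarrow> ereal" where
  "elog x = (if x = 0 then -\<infinity> else ereal (ln x))"

definition lower_semicontinuous :: "('b::topological_space \<Rightarrow> ereal) \<Rightarrow> bool" where
  "lower_semicontinuous f \<longleftrightarrow> (\<forall>x. \<forall>c < f x. \<forall>\<^sub>F y in nhds x. c < f y)"

definition rate_function :: "('b::topological_space \<Rightarrow> ereal) \<Rightarrow> bool" where
  "rate_function I \<longleftrightarrow> (\<forall>x. 0 \<le> I x) \<and> lower_semicontinuous I"

definition good_rate_function :: "('b::topological_space \<Rightarrow> ereal) \<Rightarrow> bool" where
  "good_rate_function I \<longleftrightarrow> rate_function I \<and> (\<forall>c::real. compact {x. I x \<le> ereal c})"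

text \<open>
  The \<open>n\<close>-th random variable may live on its own probability space \<open>M n\<close>. Sequences are indexed
  by \<open>n \<ge> 1\<close>; the value at \<open>n = 0\<close> is irrelevant.
\<close>

definition satisfies_LDP ::
  "(nat \<Rightarrow> 'a measure) \<Rightarrow> (nat \<Rightarrow> 'a \<Rightarrow> 'b::topological_space) \<Rightarrow> (nat \<Rightarrow> real) \<Rightarrow>
   ('b \<Rightarrow> ereal) \<Rightarrow> bool" where
  "satisfies_LDP M \<xi> s I \<longleftrightarrow>
     (\<forall>n\<ge>1. prob_space (M n) \<and> \<xi> n \<in> borel_measurable (M n)) \<and>
     rate_function I \<and>
     (\<forall>\<Gamma>\<in>sets borel.
        - (INF x\<in>interior \<Gamma>. I x)
          \<le> liminf (\<lambda>n. ereal (1 / s n) *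
               elog (measure (M n) {\<omega> \<in> space (M n). \<xi> n \<omega> \<in> interior \<Gamma>})) \<and>
        liminf (\<lambda>n. ereal (1 / s n) *
               elog (measure (M n) {\<omega> \<in> space (M n). \<xi> n \<omega> \<in> interior \<Gamma>}))
          \<le> limsup (\<lambda>n. ereal (1 / s n) *
               elog (measure (M n) {\<omega> \<in> space (M n). \<xi> n \<omega> \<in> closure \<Gamma>})) \<and>
        limsup (\<lambda>n. ereal (1 / s n) *
               elog (measure (M n) {\<omega> \<in> space (M n). \<xi> n \<omega> \<in> closure \<Gamma>}))
          \<le> - (INF x\<in>closure \<Gamma>. I x))"

definition quasiconvex :: "(real \<Rightarrow> ereal) \<Rightarrow> bool" where
  "quasiconvex f \<longleftrightarrow> (\<forall>c::real. convex {w. f w \<le> ereal c})"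

definition symmetric_fun :: "(real \<Rightarrow> ereal) \<Rightarrow> bool" where
  "symmetric_fun f \<longleftrightarrow> (\<forall>w. f (- w) = f w)"

definition r_exp :: "real \<Rightarrow> real" where
  "r_exp p = 2 * p / (2 + p)"

definition annealed_rate :: "real \<Rightarrow> real \<Rightarrow> ereal" where
  "annealed_rate p w = ereal (1 / r_exp p * \<bar>w\<bar> powr r_exp p)"

definition projection_W :: "nat \<Rightarrow> real \<Rightarrow> (nat \<Rightarrow> real) \<Rightarrow> (nat \<Rightarrow> real) \<Rightarrow> real" where
  "projection_W n p x \<theta> =
     real n powr (1 / p) / real n powr (1 / 2) * (\<Sum>i=1..n. x i * \<theta> i)"

end

theory Submission
  imports Defs "HOL-Real_Asymp.Real_Asymp"
begin

text \<open>
  By rotation invariance \<open>W\<close> has the law of \<open>n\<^sup>1\<^sup>/\<^sup>p\<^sup>-\<^sup>1\<^sup>/\<^sup>2 \<bar>X\<bar> \<Theta>\<^sub>1\<close>, where \<open>\<bar>X\<bar>\<close> is the Euclidean norm, and the two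
  factors are independent. At speed \<open>n\<^sup>r\<close> the rescaled norm has rate \<open>y\<^sup>p / p\<close> (a single coordinate of \<open>X\<close>
  is large) and the rescaled \<open>\<Theta>\<^sub>1\<close> has rate \<open>z\<^sup>2 / 2\<close>; by Young's inequality the infimum of the sum of
  these rates over \<open>y z = w\<close> is \<open>w\<^sup>r / r\<close>.

  Both factors are compared with independent Gaussian-type vectors: a vector with iid coordinates of
  density proportional to \<open>exp (- \<bar>y\<bar>\<^sup>p / p)\<close> is a random dilation of the uniform point \<open>X\<close>, and a
  standard normal variable is a random dilation of \<open>\<Theta>\<^sub>1\<close>. The dilations are concentrated
  exponentially in \<open>n\<close>, hence invisible at the speed \<open>n\<^sup>r\<close> with \<open>r < 1\<close>. The upper bound follows from
  exponential moments: \<open>E exp (a n\<^sup>r \<bar>W\<bar>\<^sup>r / r) \<le> E exp (a n \<bar>X\<bar>\<^sup>p / p) E exp (a n \<Theta>\<^sub>1\<^sup>2 / 2)\<close> for \<open>a < 1\<close>, and the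
  right-hand side is \<open>exp (O (n\<^sup>p\<^sup>/\<^sup>2))\<close>, where \<open>p / 2 < r\<close>.
\<close>

section \<open>The p-Gaussian distribution\<close>

text \<open>The exponent r is fixed by 1/r = 1/p + 1/2. This says at once that p/r and 2/r are
  conjugate in Young's inequality and that \<open>n powr r * W_scale n p powr r = n\<close>, so a
  tilt of order n^r of the product splits into one tilt of order n for each factor. The lower bound
  uses the equality case, with rescaled sizes w^(r/p) and w^(r/2). The factor a must stay below 1,
  since at a = 1 the p-Gaussian moment diverges; the loss is absorbed by the slack h that every
  estimate carries. The delicate point is the moment of |Y|^p for a p-Gaussian vector Y. Bounding
  |Y|^p by the sum of the |Y_i|^p gives exp (O(n)), which is useless at speed n^r with r < 1. The
  typical size |Y| ~ sqrt n leaves room for exp (O(n^(p/2))), and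
  \<open>sum_powr_le_truncated\<close> is built to reach it: small coordinates are counted
  quadratically, large ones by their p-th power. Both p/2 < r and r < 1 amount to p < 2. Since the
  rate increases with |w|, tails of |W| and short intervals on either side of 0 decide the full
  principle.\<close>

definition pgauss_const :: "real \<Rightarrow> real" where
  "pgauss_const q = enn2real (\<integral>\<^sup>+y. ennreal (exp (- (\<bar>y\<bar> powr q / q))) \<partial>lborel)"

definition pgauss :: "real \<Rightarrow> real measure" where
  "pgauss q = density lborel (\<lambda>y. ennreal (exp (- (\<bar>y\<bar> powr q / q)) / pgauss_const q))"

lemma sets_pgauss [simp, measurable_cong]: "sets (pgauss q) = sets borel"
  by (simp add: pgauss_def)

lemma space_pgauss [simp]: "space (pgauss q) = UNIV"
  by (simp add: pgauss_def)

lemma abs_le_one_plus_powr: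
  fixes y q :: real
  assumes "q \<ge> 1"
  shows "\<bar>y\<bar> \<le> 1 + \<bar>y\<bar> powr q"
proof (cases "\<bar>y\<bar> \<le> 1")
  case True
  then show ?thesis by (smt (verit) powr_ge_zero)
next
  case False
  then show ?thesis using powr_mono[of 1 q "\<bar>y\<bar>"] assms by auto
qed

lemma nn_integral_exp_abs_finite:
  assumes "q > 0"
  shows "(\<integral>\<^sup>+y. ennreal (exp (- (\<bar>y\<bar> / q))) \<partial>lborel) < \<infinity>"
proof -
  let ?e = "\<lambda>y. ennreal (exponential_density (1/q) y)"
  have 1: "(\<integral>\<^sup>+y. ?e y \<partial>lborel) = 1"
    using prob_space.emeasure_space_1[OF prob_space_exponential_density[of "1/q"]] assms
    by (simp add: emeasure_density)
  have 2: "(\<integral>\<^sup>+y. ?e (- y) \<partial>lborel) = 1"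
    using nn_integral_real_affine[of ?e "-1" 0] 1 by simp
  have "(\<integral>\<^sup>+y. ennreal (exp (- (\<bar>y\<bar> / q))) \<partial>lborel)
      \<le> (\<integral>\<^sup>+y. ennreal q * (?e y + ?e (- y)) \<partial>lborel)"
  proof (intro nn_integral_mono)
    fix y :: real
    \<comment> \<open>The majorant is the exponential density of rate 1/q plus its mirror image;
      both are positive at y = 0, hence only an inequality.\<close>
    have "exp (- (\<bar>y\<bar> / q)) \<le> q * (exponential_density (1/q) y + exponential_density (1/q) (- y))"
      using assms by (auto simp: exponential_density_def abs_if field_simps)
    then show "ennreal (exp (- (\<bar>y\<bar> / q))) \<le> ennreal q * (?e y + ?e (- y))"
      using assms by (simp add: ennreal_mult'[symmetric] ennreal_plus[symmetric] exponential_density_nonneg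
          ennreal_leI del: ennreal_plus)
  qed
  also have "\<dots> = ennreal q * 2"
    by (simp add: nn_integral_cmult nn_integral_add 1 2)
  also have "\<dots> < \<infinity>"
    by (simp add: ennreal_mult_less_top)
  finally show ?thesis .
qed

text \<open>\<open>enn2real\<close> sends infinity to 0, so the constant means something only once
  the integral is known to be finite; \<bar>y\<bar> <= 1 + \<bar>y\<bar>^q reduces this to the
  two-sided exponential.\<close>

lemma pgauss_const:
  assumes "q \<ge> 1"
  shows "(\<integral>\<^sup>+y. ennreal (exp (- (\<bar>y\<bar> powr q / q))) \<partial>lborel) = ennreal (pgauss_const q)"
    and "pgauss_const q > 0"
proof -
  let ?I = "\<integral>\<^sup>+y. ennreal (exp (- (\<bar>y\<bar> powr q / q))) \<partial>lborel"
  have "?I \<le> (\<integral>\<^sup>+y. ennreal (exp (1 / q)) * ennreal (exp (- (\<bar>y\<bar> / q))) \<partial>lborel)"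
  proof (intro nn_integral_mono)
    fix y :: real
    have "\<bar>y\<bar> \<le> 1 + \<bar>y\<bar> powr q"
      using assms by (intro abs_le_one_plus_powr) auto
    then have "- (\<bar>y\<bar> powr q / q) \<le> 1 / q + - (\<bar>y\<bar> / q)"
      using assms by (simp add: field_simps)
    then show "ennreal (exp (- (\<bar>y\<bar> powr q / q))) \<le> ennreal (exp (1 / q)) * ennreal (exp (- (\<bar>y\<bar> / q)))"
      by (simp add: ennreal_mult'[symmetric] exp_add[symmetric] ennreal_leI)
  qed
  also have "\<dots> < \<infinity>"
    using nn_integral_exp_abs_finite[of q] assms
    by (simp add: nn_integral_cmult ennreal_mult_less_top)
  finally have fin: "?I < \<infinity>" .
  have "?I \<noteq> 0"
  proof
    assume "?I = 0"
    then have "AE y::real in lborel. False"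
      by (subst (asm) nn_integral_0_iff_AE) auto
    then show False
      using AE_iff_measurable[of UNIV lborel "\<lambda>_::real. False"] by auto
  qed
  then show "?I = ennreal (pgauss_const q)" "pgauss_const q > 0"
    using fin unfolding pgauss_const_def by (auto simp: enn2real_positive_iff zero_less_iff_neq_zero)
qed

lemma nn_integral_pgauss:
  assumes "q \<ge> 1" and [measurable]: "f \<in> borel_measurable borel"
  shows "(\<integral>\<^sup>+y. f y \<partial>pgauss q)
       = (\<integral>\<^sup>+y. ennreal (exp (- (\<bar>y\<bar> powr q / q))) * f y \<partial>lborel) / ennreal (pgauss_const q)"
proof -
  have "(\<integral>\<^sup>+y. f y \<partial>pgauss q)
      = (\<integral>\<^sup>+y. (ennreal (exp (- (\<bar>y\<bar> powr q / q))) * f y) / ennreal (pgauss_const q) \<partial>lborel)"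
    unfolding pgauss_def using pgauss_const[OF assms(1)]
    by (subst nn_integral_density) (auto simp: divide_ennreal[symmetric] ennreal_times_divide mult.commute
         intro!: nn_integral_cong)
  then show ?thesis
    by (simp add: nn_integral_divide)
qed

lemma prob_space_pgauss:
  assumes "q \<ge> 1"
  shows "prob_space (pgauss q)"
proof
  have "emeasure (pgauss q) (space (pgauss q)) = (\<integral>\<^sup>+y. 1 \<partial>pgauss q)"
    by simp
  also have "\<dots> = 1"
    unfolding nn_integral_pgauss[OF assms borel_measurable_const] using pgauss_const[OF assms]
    by (simp add: ennreal_divide_self)
  finally show "emeasure (pgauss q) (space (pgauss q)) = 1" .
qed

text \<open>Tilting by exp (l \<bar>y\<bar>^q) is a change of scale: with t^q = 1 - l q the
  substitution y -> t y produces exactly the tilted density, and the Jacobian leaves 1/t.\<close>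

lemma pgauss_mgf:
  assumes q: "q \<ge> 1" and l: "l * q < 1"
  shows "(\<integral>\<^sup>+y. ennreal (exp (l * \<bar>y\<bar> powr q)) \<partial>pgauss q) = ennreal ((1 - l * q) powr (- (1 / q)))"
proof -
  define t where "t = (1 - l * q) powr (1 / q)"
  have t: "t > 0" "t powr q = 1 - l * q"
    using assms by (auto simp: t_def powr_powr)
  let ?g = "\<lambda>y. ennreal (exp (- (\<bar>y\<bar> powr q / q)))"
  have "ennreal (pgauss_const q) = ennreal t * (\<integral>\<^sup>+y. ?g (t * y) \<partial>lborel)"
    using nn_integral_real_affine[of ?g t 0] t pgauss_const[OF q] by simp
  also have "(\<lambda>y. ?g (t * y)) = (\<lambda>y. ?g y * ennreal (exp (l * \<bar>y\<bar> powr q)))"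
  proof
    fix y
    have "- (\<bar>t * y\<bar> powr q / q) = - (\<bar>y\<bar> powr q / q) + l * \<bar>y\<bar> powr q"
    proof -
      have "\<bar>t * y\<bar> powr q = (1 - l * q) * \<bar>y\<bar> powr q"
        using t by (simp add: abs_mult powr_mult)
      then show ?thesis
        using q by (simp add: field_simps)
    qed
    then show "?g (t * y) = ?g y * ennreal (exp (l * \<bar>y\<bar> powr q))"
      by (simp add: ennreal_mult'[symmetric] exp_add[symmetric])
  qed
  finally have *: "ennreal (pgauss_const q)
     = ennreal t * (\<integral>\<^sup>+y. ?g y * ennreal (exp (l * \<bar>y\<bar> powr q)) \<partial>lborel)" (is "_ = _ * ?J") .
  have "?J = ennreal (pgauss_const q / t)"
  proof -
    have "?J = ennreal (inverse t) * (ennreal t * ?J)"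
      using t by (simp add: mult.assoc[symmetric] ennreal_mult'[symmetric])
    also have "\<dots> = ennreal (pgauss_const q / t)"
      unfolding *[symmetric] using t
      by (simp add: ennreal_mult'[symmetric] divide_inverse mult.commute)
    finally show ?thesis .
  qed
  then have "(\<integral>\<^sup>+y. ennreal (exp (l * \<bar>y\<bar> powr q)) \<partial>pgauss q) = ennreal (1 / t)"
    using pgauss_const[OF q] t by (simp add: nn_integral_pgauss[OF q] divide_ennreal)
  then show ?thesis
    by (simp add: t_def powr_minus divide_inverse)
qed

text \<open>A quadratic factor is traded for an arbitrarily small exponential rate, by squaring c (1
  + v) <= 1 + c v <= exp (c v).\<close>

lemma square_le_exp:
  fixes v c :: real
  assumes "v \<ge> 0" "0 < c" "c \<le> 1"
  shows "(1 + v)\<^sup>2 \<le> exp (2 * c * v) / c\<^sup>2"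
proof -
  have "c * (1 + v) \<le> 1 + c * v"
    using assms by (simp add: field_simps)
  also have "\<dots> \<le> exp (c * v)"
    by (rule exp_ge_add_one_self)
  finally have "(c * (1 + v))\<^sup>2 \<le> (exp (c * v))\<^sup>2"
    using assms by (intro power_mono) auto
  then show ?thesis
    using assms unfolding power_mult_distrib exp_double[symmetric] by (simp add: field_simps)
qed

lemma pgauss_square_exp_finite:
  assumes q: "q \<ge> 1" and e: "0 < e" "e \<le> 1"
  shows "\<exists>K\<ge>0. (\<integral>\<^sup>+y. ennreal (y\<^sup>2 * exp ((1 - e) / q * \<bar>y\<bar> powr q)) \<partial>pgauss q) \<le> ennreal K"
proof -
  \<comment> \<open>With this c the rate grows by 2 c = e / (2 q), half of the gap e / q to the
    critical rate 1 / q.\<close>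
  define c where "c = e / (4 * q)"
  have c: "0 < c" "c \<le> 1"
    using assms by (auto simp: c_def field_simps)
  have "(\<integral>\<^sup>+y. ennreal (y\<^sup>2 * exp ((1 - e) / q * \<bar>y\<bar> powr q)) \<partial>pgauss q)
     \<le> (\<integral>\<^sup>+y. ennreal (1 / c\<^sup>2) * ennreal (exp ((1 - e/2) / q * \<bar>y\<bar> powr q)) \<partial>pgauss q)"
  proof (intro nn_integral_mono)
    fix y :: real
    have "\<bar>y\<bar> \<le> 1 + \<bar>y\<bar> powr q"
      using assms by (intro abs_le_one_plus_powr) auto
    then have "y\<^sup>2 \<le> (1 + \<bar>y\<bar> powr q)\<^sup>2"
      by (metis abs_ge_zero power2_abs power_mono)
    also have "\<dots> \<le> exp (2 * c * \<bar>y\<bar> powr q) / c\<^sup>2"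
      by (rule square_le_exp) (use c in auto)
    finally have "y\<^sup>2 * exp ((1 - e) / q * \<bar>y\<bar> powr q)
        \<le> exp (2 * c * \<bar>y\<bar> powr q) / c\<^sup>2 * exp ((1 - e) / q * \<bar>y\<bar> powr q)"
      by (intro mult_right_mono) auto
    also have "\<dots> = 1 / c\<^sup>2 * exp ((1 - e/2) / q * \<bar>y\<bar> powr q)"
      unfolding c_def using assms by (simp add: exp_add[symmetric] field_simps)
    finally show "ennreal (y\<^sup>2 * exp ((1 - e) / q * \<bar>y\<bar> powr q))
       \<le> ennreal (1 / c\<^sup>2) * ennreal (exp ((1 - e/2) / q * \<bar>y\<bar> powr q))"
      by (simp add: ennreal_mult'[symmetric] ennreal_leI)
  qed
  also have "\<dots> = ennreal (1 / c\<^sup>2 * (e / 2) powr (- (1 / q)))"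
    using q e pgauss_mgf[of q "(1 - e/2) / q"]
    by (subst nn_integral_cmult) (auto simp: ennreal_mult'[symmetric])
  finally show ?thesis
    by (intro exI[of _ "1 / c\<^sup>2 * (e / 2) powr (- (1 / q))"]) auto
qed

text \<open>The tail contains [x, x+1], on which the density is smallest at the right end. The shift
  by 1 is of lower order once x grows like a power of n.\<close>

lemma pgauss_tail_lower:
  assumes q: "q \<ge> 1" and x: "x \<ge> 0"
  shows "ennreal (exp (- ((x + 1) powr q / q)) / pgauss_const q) \<le> emeasure (pgauss q) {x..}"
proof -
  have "ennreal (exp (- ((x + 1) powr q / q)) / pgauss_const q)
     = (\<integral>\<^sup>+y. ennreal (exp (- ((x + 1) powr q / q)) / pgauss_const q) * indicator {x..x+1} y \<partial>lborel)"
    by (simp add: nn_integral_cmult_indicator)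
  also have "\<dots> \<le> (\<integral>\<^sup>+y. ennreal (exp (- (\<bar>y\<bar> powr q / q)) / pgauss_const q) * indicator {x..} y \<partial>lborel)"
  proof (intro nn_integral_mono)
    fix y :: real
    show "ennreal (exp (- ((x + 1) powr q / q)) / pgauss_const q) * indicator {x..x+1} y
        \<le> ennreal (exp (- (\<bar>y\<bar> powr q / q)) / pgauss_const q) * indicator {x..} y"
    proof (cases "y \<in> {x..x+1}")
      case True
      then have "\<bar>y\<bar> powr q \<le> (x + 1) powr q"
        using x q by (intro powr_mono2) auto
      then show ?thesis
        using True q pgauss_const[OF q] by (auto intro!: ennreal_leI divide_right_mono)
    qed auto
  qed
  also have "\<dots> = emeasure (pgauss q) {x..}"
    by (simp add: pgauss_def emeasure_density)
  finally show ?thesis .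
qed

text \<open>Both are probability densities proportional to exp (- y^2 / 2), so the normalising
  constants must agree.\<close>

lemma pgauss_2: "pgauss 2 = density lborel std_normal_density"
proof -
  have "1 = (\<integral>\<^sup>+y. ennreal (std_normal_density y) \<partial>lborel)"
    using prob_space.emeasure_space_1[OF prob_space_normal_density[of 1 0]]
    by (simp add: emeasure_density)
  also have "\<dots> = (\<integral>\<^sup>+y. ennreal (1 / sqrt (2 * pi)) * ennreal (exp (- (\<bar>y\<bar> powr 2 / 2))) \<partial>lborel)"
    by (intro nn_integral_cong) (simp add: std_normal_density_def ennreal_mult'[symmetric])
  also have "\<dots> = ennreal (1 / sqrt (2 * pi) * pgauss_const 2)"
    using pgauss_const[of 2] by (subst nn_integral_cmult) (auto simp: ennreal_mult'[symmetric])
  finally have "1 / sqrt (2 * pi) * pgauss_const 2 = 1"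
    by (metis ennreal_eq_1)
  then have "pgauss_const 2 = sqrt (2 * pi)"
    by (simp add: field_simps)
  then show ?thesis
    unfolding pgauss_def by (intro density_cong) (auto simp: std_normal_density_def)
qed

section \<open>Product measures on Euclidean space\<close>

lemma sets_lebesgue_Rn [measurable_cong]: "sets (lebesgue_Rn n) = sets (borel_Rn n)"
  by (intro sets_PiM_cong) auto

text \<open>A product measure is determined by its values on boxes, where the dilation acts
  coordinate by coordinate and each coordinate contributes one factor c.\<close>

lemma nn_integral_Rn_scale:
  assumes c: "c > 0" and [measurable]: "f \<in> borel_measurable (borel_Rn n)"
  shows "(\<integral>\<^sup>+x. f x \<partial>lebesgue_Rn n)
       = ennreal (c ^ n) * (\<integral>\<^sup>+x. f (\<lambda>i\<in>{1..n}. c * x i) \<partial>lebesgue_Rn n)"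
proof -
  interpret product_sigma_finite "\<lambda>_::nat. lborel :: real measure" by standard
  let ?s = "\<lambda>x. \<lambda>i\<in>{1..n}. c * x i"
  let ?P = "density (distr (lebesgue_Rn n) (lebesgue_Rn n) ?s) (\<lambda>_. ennreal (c ^ n))"
  have [measurable]: "?s \<in> measurable (lebesgue_Rn n) (lebesgue_Rn n)"
    by (intro measurable_restrict) measurable
  have "?P = lebesgue_Rn n"
  proof (rule PiM_eqI)
    fix A :: "nat \<Rightarrow> real set"
    assume A: "\<And>i. i \<in> {1..n} \<Longrightarrow> A i \<in> sets lborel"
    then have [measurable]: "Pi\<^sub>E {1..n} A \<in> sets (lebesgue_Rn n)"
      by (intro sets_PiM_I_finite) auto
    have pre: "?s -` Pi\<^sub>E {1..n} A \<inter> space (lebesgue_Rn n) = (\<Pi>\<^sub>E i\<in>{1..n}. (\<lambda>x. c * x) -` A i)"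
      by (auto simp: space_PiM PiE_iff extensional_def restrict_def)
    have m: "(\<lambda>x. c * x) -` A i \<in> sets lborel" if "i \<in> {1..n}" for i
      using measurable_sets[of "(\<lambda>x. c * x)" lborel lborel "A i"] A[OF that] by auto
    have "emeasure ?P (Pi\<^sub>E {1..n} A) = ennreal (c ^ n) * emeasure (lebesgue_Rn n) (\<Pi>\<^sub>E i\<in>{1..n}. (\<lambda>x. c * x) -` A i)"
      by (simp add: emeasure_density nn_integral_cmult emeasure_distr pre del: One_nat_def)
    also have "\<dots> = (\<Prod>i\<in>{1..n}. ennreal c * emeasure lborel ((\<lambda>x. c * x) -` A i))"
      using m c by (subst emeasure_PiM) (auto simp: prod.distrib ennreal_power)
    also have "\<dots> = (\<Prod>i\<in>{1..n}. emeasure lborel (A i))"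
    proof (intro prod.cong refl)
      fix i assume i: "i \<in> {1..n}"
      have "emeasure lborel (A i) = emeasure (density (distr lborel borel (\<lambda>x. 0 + c * x)) (\<lambda>_. ennreal \<bar>c\<bar>)) (A i)"
        using lborel_real_affine[of c 0] c by simp
      also have "\<dots> = ennreal c * emeasure lborel ((\<lambda>x. c * x) -` A i)"
        using A[OF i] c by (simp add: emeasure_density nn_integral_cmult emeasure_distr)
      finally show "ennreal c * emeasure lborel ((\<lambda>x. c * x) -` A i) = emeasure lborel (A i)" ..
    qed
    finally show "emeasure ?P (Pi\<^sub>E {1..n} A) = (\<Prod>i\<in>{1..n}. emeasure lborel (A i))" .
  qed simp_all
  then have "(\<integral>\<^sup>+x. f x \<partial>lebesgue_Rn n) = (\<integral>\<^sup>+x. f x \<partial>?P)"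
    by simp
  also have "\<dots> = ennreal (c ^ n) * (\<integral>\<^sup>+x. f (?s x) \<partial>lebesgue_Rn n)"
    by (simp add: nn_integral_density nn_integral_cmult nn_integral_distr del: One_nat_def)
  finally show ?thesis .
qed

lemma nn_integral_pgauss_Rn:
  assumes q: "q \<ge> 1" and [measurable]: "f \<in> borel_measurable (borel_Rn n)"
  shows "(\<integral>\<^sup>+y. f y \<partial>PiM {1..n} (\<lambda>_. pgauss q))
       = (\<integral>\<^sup>+y. ennreal (exp (- ((\<Sum>i=1..n. \<bar>y i\<bar> powr q) / q)) / pgauss_const q ^ n) * f y \<partial>lebesgue_Rn n)"
proof -
  interpret prob_space "pgauss q" by (rule prob_space_pgauss[OF q])
  interpret G: product_sigma_finite "\<lambda>_::nat. pgauss q" by standard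
  interpret L: product_sigma_finite "\<lambda>_::nat. lborel :: real measure" by standard
  let ?d = "\<lambda>t. ennreal (exp (- (\<bar>t\<bar> powr q / q)) / pgauss_const q)"
  let ?D = "\<lambda>y. \<Prod>i\<in>{1..n}. ?d (y i)"
  have D: "?D y = ennreal (exp (- ((\<Sum>i=1..n. \<bar>y i\<bar> powr q) / q)) / pgauss_const q ^ n)" for y
    using pgauss_const[OF q]
    by (simp add: prod_ennreal prod_dividef exp_sum[symmetric] sum_negf sum_divide_distrib)
  have "density (lebesgue_Rn n) ?D = PiM {1..n} (\<lambda>_. pgauss q)"
  proof (rule G.PiM_eqI)
    show "sets (density (lebesgue_Rn n) ?D) = sets (PiM {1..n} (\<lambda>_. pgauss q))"
      by (auto intro!: sets_PiM_cong)
    fix A :: "nat \<Rightarrow> real set"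
    assume A: "\<And>i. i \<in> {1..n} \<Longrightarrow> A i \<in> sets (pgauss q)"
    then have [measurable]: "Pi\<^sub>E {1..n} A \<in> sets (lebesgue_Rn n)"
      by (intro sets_PiM_I_finite) auto
    have "emeasure (density (lebesgue_Rn n) ?D) (Pi\<^sub>E {1..n} A)
        = (\<integral>\<^sup>+y. (\<Prod>i\<in>{1..n}. ?d (y i) * indicator (A i) (y i)) \<partial>lebesgue_Rn n)"
    proof (subst emeasure_density; (intro nn_integral_cong)?)
      fix y assume "y \<in> space (lebesgue_Rn n)"
      then have "indicator (Pi\<^sub>E {1..n} A) y = (\<Prod>i\<in>{1..n}. indicator (A i) (y i) :: ennreal)"
        by (auto simp: indicator_def space_PiM PiE_iff intro!: prod_zero prod.neutral[symmetric])
      then show "?D y * indicator (Pi\<^sub>E {1..n} A) y = (\<Prod>i\<in>{1..n}. ?d (y i) * indicator (A i) (y i))"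
        by (simp add: prod.distrib)
    qed measurable
    also have "\<dots> = (\<Prod>i\<in>{1..n}. \<integral>\<^sup>+t. ?d t * indicator (A i) t \<partial>lborel)"
      using A by (intro L.product_nn_integral_prod) auto
    also have "\<dots> = (\<Prod>i\<in>{1..n}. emeasure (pgauss q) (A i))"
      using A unfolding pgauss_def by (intro prod.cong) (auto simp: emeasure_density)
    finally show "emeasure (density (lebesgue_Rn n) ?D) (Pi\<^sub>E {1..n} A) = (\<Prod>i\<in>{1..n}. emeasure (pgauss q) (A i))" .
  qed simp
  then have "(\<integral>\<^sup>+y. f y \<partial>PiM {1..n} (\<lambda>_. pgauss q)) = (\<integral>\<^sup>+y. f y \<partial>density (lebesgue_Rn n) ?D)"
    by simp
  also have "\<dots> = (\<integral>\<^sup>+y. ?D y * f y \<partial>lebesgue_Rn n)"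
    by (rule nn_integral_density) measurable
  finally show ?thesis by (simp only: D)
qed

section \<open>The p-Gaussian vector as a mixture over dilated balls\<close>

lemma nn_integral_exp_tail:
  assumes "q > 0"
  shows "(\<integral>\<^sup>+u. ennreal (exp (- (u / q)) / q) * indicator {s..} u \<partial>lborel) = ennreal (exp (- (s / q)))"
proof -
  have "((\<lambda>u::real. - exp (- (u / q))) \<longlongrightarrow> - 0) at_top"
    using assms by (intro tendsto_minus filterlim_compose[OF exp_at_bot]) real_asymp
  then show ?thesis
    using assms
    by (subst nn_integral_FTC_atLeast[where F="\<lambda>u. - exp (- (u / q))" and T=0])
       (auto intro!: derivative_eq_intros)
qed

lemma measurable_lp_ball [measurable]: "lp_ball n p \<in> sets (borel_Rn n)"
  unfolding lp_ball_def by measurable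

text \<open>The layer-cake formula for \<open>exp (- s / p)\<close>, followed by rescaling of each layer, exhibits the
  \<open>p\<close>-Gaussian vector as a randomly dilated uniform point of the ball.\<close>

lemma nn_integral_pgauss_layers:
  assumes p: "p \<ge> 1" and [measurable]: "f \<in> borel_measurable (borel_Rn n)"
  shows "(\<integral>\<^sup>+y. f y \<partial>PiM {1..n} (\<lambda>_. pgauss p))
     = (\<integral>\<^sup>+u. ennreal (exp (- (u / p)) * u powr (n / p) / (p * pgauss_const p ^ n)) * indicator {0<..} u *
          (\<integral>\<^sup>+x. f (\<lambda>i\<in>{1..n}. u powr (1 / p) * x i) * indicator (lp_ball n p) x \<partial>lebesgue_Rn n) \<partial>lborel)"
proof -
  interpret L: product_sigma_finite "\<lambda>_::nat. lborel :: real measure" by standard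
  interpret LS: sigma_finite_measure "lebesgue_Rn n" by (rule L.sigma_finite) simp
  interpret P: pair_sigma_finite "lebesgue_Rn n" "lborel :: real measure" by standard
  define k where "k = 1 / pgauss_const p ^ n"
  have k: "k > 0" using pgauss_const[OF p] by (simp add: k_def)
  let ?N = "\<lambda>y. \<Sum>i=1..n. \<bar>y i\<bar> powr p"
  let ?e = "\<lambda>u::real. ennreal (exp (- (u / p)) / p)"
  have "(\<integral>\<^sup>+y. f y \<partial>PiM {1..n} (\<lambda>_. pgauss p))
     = (\<integral>\<^sup>+y. (\<integral>\<^sup>+u. ennreal k * f y * (?e u * indicator {?N y..} u) \<partial>lborel) \<partial>lebesgue_Rn n)"
    unfolding nn_integral_pgauss_Rn[OF assms]
  proof (intro nn_integral_cong)
    fix y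
    have "(\<integral>\<^sup>+u. ennreal k * f y * (?e u * indicator {?N y..} u) \<partial>lborel)
        = ennreal k * f y * ennreal (exp (- (?N y / p)))"
      using p by (subst nn_integral_cmult) (auto simp: nn_integral_exp_tail)
    also have "\<dots> = ennreal (exp (- (?N y / p)) * k) * f y"
      using k by (subst ennreal_mult) (auto simp: mult_ac)
    finally show "ennreal (exp (- (?N y / p)) / pgauss_const p ^ n) * f y
        = (\<integral>\<^sup>+u. ennreal k * f y * (?e u * indicator {?N y..} u) \<partial>lborel)"
      by (simp add: k_def)
  qed
  also have "\<dots> = (\<integral>\<^sup>+u. (\<integral>\<^sup>+y. ennreal k * f y * (?e u * indicator {?N y..} u) \<partial>lebesgue_Rn n) \<partial>lborel)"
  proof (rule P.Fubini'[symmetric])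
    have "(\<lambda>(y, u). indicator {?N y..} u :: ennreal) = (\<lambda>(y, u). if ?N y \<le> u then 1 else 0)"
      by (auto simp: fun_eq_iff indicator_def)
    also have "\<dots> \<in> borel_measurable (lebesgue_Rn n \<Otimes>\<^sub>M lborel)"
      by measurable
    finally have [measurable]: "(\<lambda>(y, u). indicator {?N y..} u :: ennreal) \<in> borel_measurable (lebesgue_Rn n \<Otimes>\<^sub>M lborel)" .
    show "(\<lambda>(y, u). ennreal k * f y * (?e u * indicator {?N y..} u)) \<in> borel_measurable (lebesgue_Rn n \<Otimes>\<^sub>M lborel)"
      by measurable
  qed
  also have "\<dots> = (\<integral>\<^sup>+u. ennreal (exp (- (u / p)) * u powr (n / p) / (p * pgauss_const p ^ n)) * indicator {0<..} u *
          (\<integral>\<^sup>+x. f (\<lambda>i\<in>{1..n}. u powr (1 / p) * x i) * indicator (lp_ball n p) x \<partial>lebesgue_Rn n) \<partial>lborel)"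
  proof (rule nn_integral_cong_AE)
    \<comment> \<open>The level u = 0 is a null set, and below it both sides vanish because the
      sublevel sets of the power sum are empty.\<close>
    show "AE u in lborel. (\<integral>\<^sup>+y. ennreal k * f y * (?e u * indicator {?N y..} u) \<partial>lebesgue_Rn n)
       = ennreal (exp (- (u / p)) * u powr (n / p) / (p * pgauss_const p ^ n)) * indicator {0<..} u *
          (\<integral>\<^sup>+x. f (\<lambda>i\<in>{1..n}. u powr (1 / p) * x i) * indicator (lp_ball n p) x \<partial>lebesgue_Rn n)"
      using AE_lborel_singleton[of "0::real"]
    proof eventually_elim
      case (elim u)
      show ?case
      proof (cases "u > 0")
        case False
        then have "u < 0" using elim by simp
        then have "u < ?N y" for y
          by (smt (verit) powr_ge_zero sum_nonneg)
        then show ?thesis using False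
          by (simp add: not_le)
      next
        case True
        \<comment> \<open>The dilation by c carries the unit ball onto the sublevel set at height u;
          its Jacobian c^n is the source of the factor \<open>u powr (n / p)\<close>.\<close>
        define c where "c = u powr (1 / p)"
        have c: "c > 0" "c powr p = u" "c ^ n = u powr (n / p)"
          using True p by (auto simp: c_def powr_powr powr_realpow[symmetric])
        let ?s = "\<lambda>x. \<lambda>i\<in>{1..n}. c * x i"
        have N: "?N (?s x) = u * ?N x" for x
        proof -
          have "?N (?s x) = (\<Sum>i=1..n. c powr p * \<bar>x i\<bar> powr p)"
            using c(1) by (intro sum.cong) (auto simp: abs_mult powr_mult)
          then show ?thesis by (simp add: sum_distrib_left c(2))
        qed
        have "(\<integral>\<^sup>+y. ennreal k * f y * (?e u * indicator {?N y..} u) \<partial>lebesgue_Rn n)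
            = (\<integral>\<^sup>+y. ennreal (k * exp (- (u / p)) / p) * (f y * indicator {..u} (?N y)) \<partial>lebesgue_Rn n)"
        proof (intro nn_integral_cong)
          fix y
          have "ennreal (k * exp (- (u / p)) / p) = ennreal k * ?e u"
            using k p by (simp add: ennreal_mult'[symmetric])
          then show "ennreal k * f y * (?e u * indicator {?N y..} u)
              = ennreal (k * exp (- (u / p)) / p) * (f y * indicator {..u} (?N y))"
            by (auto simp: indicator_def mult_ac)
        qed
        also have "\<dots> = ennreal (k * exp (- (u / p)) / p) * (\<integral>\<^sup>+y. (f y * indicator {..u} (?N y)) \<partial>lebesgue_Rn n)"
          by (rule nn_integral_cmult) measurable
        also have "(\<integral>\<^sup>+y. (f y * indicator {..u} (?N y)) \<partial>lebesgue_Rn n)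
            = ennreal (c ^ n) * (\<integral>\<^sup>+x. f (?s x) * indicator {..u} (?N (?s x)) \<partial>lebesgue_Rn n)"
          by (rule nn_integral_Rn_scale[OF c(1)]) measurable
        also have "(\<integral>\<^sup>+x. f (?s x) * indicator {..u} (?N (?s x)) \<partial>lebesgue_Rn n)
            = (\<integral>\<^sup>+x. f (?s x) * indicator (lp_ball n p) x \<partial>lebesgue_Rn n)"
          unfolding N using True
          by (intro nn_integral_cong) (auto simp: indicator_def lp_ball_def space_PiM)
        finally show ?thesis
          unfolding c_def[symmetric] c(3) using True k p
          by (simp add: mult.assoc[symmetric] ennreal_mult''[symmetric] k_def)
            (simp add: field_simps)
      qed
    qed
  qed
  finally show ?thesis .
qed

text \<open>The terms of the right-hand side are at most linear in \<open>u\<close>, which keeps their exponential moments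
  close to \<open>1\<close>, and at most of order \<open>u powr s\<close>, which keeps them finite.\<close>

lemma sum_powr_le_truncated:
  fixes u :: "'a \<Rightarrow> real"
  assumes s: "0 < s" "s \<le> 1" and A: "finite A" "\<And>i. i \<in> A \<Longrightarrow> u i \<ge> 0"
  shows "(\<Sum>i\<in>A. u i) powr s \<le> 1 + (\<Sum>i\<in>A. min (u i) (u i powr s))"
proof -
  \<comment> \<open>On B the minimum is u itself, and the whole block is handled by t^s <= 1 + t,
    which is where the single 1 comes from. Off B the minimum is u^s, and subadditivity of t^s
    applies term by term.\<close>
  define B where "B = {i\<in>A. u i \<le> 1}"
  have sub: "(x + y) powr s \<le> x powr s + y powr s" if "x \<ge> 0" "y \<ge> 0" for x y :: real
  proof (cases "x + y = 0")
    case False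
    then have pos: "x + y > 0" using that by simp
    have *: "t \<le> t powr s" if "0 \<le> t" "t \<le> 1" for t :: real
      using powr_mono'[of s 1 t] that s by (cases "t = 0") auto
    have "1 = x / (x + y) + y / (x + y)"
      using pos by (simp add: add_divide_distrib[symmetric])
    also have "\<dots> \<le> (x / (x + y)) powr s + (y / (x + y)) powr s"
      using that pos by (intro add_mono *) auto
    also have "\<dots> = (x powr s + y powr s) / (x + y) powr s"
      using that pos by (simp add: powr_divide add_divide_distrib)
    finally show ?thesis
      using pos by (simp add: field_simps)
  qed (use that in auto)
  have big: "(\<Sum>i\<in>C. u i) powr s \<le> (\<Sum>i\<in>C. u i powr s)" if "C \<subseteq> A" for C
    using finite_subset[OF that A(1)] that
  proof (induction C rule: finite_induct)
    case (insert i C)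
    then have "(u i + (\<Sum>i\<in>C. u i)) powr s \<le> u i powr s + (\<Sum>i\<in>C. u i) powr s"
      using A by (intro sub sum_nonneg) auto
    then show ?case using insert by auto
  qed simp
  have small: "t powr s \<le> 1 + t" if "t \<ge> 0" for t :: real
  proof (cases "t \<le> 1")
    case True
    then show ?thesis using powr_mono2[of s t 1] that s by auto
  next
    case False
    then show ?thesis using powr_mono[of s 1 t] s by auto
  qed
  have split: "(\<Sum>i\<in>A. f i) = (\<Sum>i\<in>B. f i) + (\<Sum>i\<in>A - B. f i)" for f :: "'a \<Rightarrow> real"
    using sum.subset_diff[of B A f] A(1) by (auto simp: B_def add.commute)
  have "(\<Sum>i\<in>A. u i) powr s \<le> (\<Sum>i\<in>B. u i) powr s + (\<Sum>i\<in>A-B. u i) powr s"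
    unfolding split[of u] using A by (intro sub sum_nonneg) (auto simp: B_def)
  also have "\<dots> \<le> (1 + (\<Sum>i\<in>B. u i)) + (\<Sum>i\<in>A-B. u i powr s)"
    using A by (intro add_mono small big sum_nonneg) (auto simp: B_def)
  also have "(\<Sum>i\<in>B. u i) = (\<Sum>i\<in>B. min (u i) (u i powr s))"
  proof (intro sum.cong refl)
    fix i assume i: "i \<in> B"
    then have "u i \<le> u i powr s"
      using powr_mono'[of s 1 "u i"] s A by (cases "u i = 0") (auto simp: B_def)
    then show "u i = min (u i) (u i powr s)" by simp
  qed
  also have "(\<Sum>i\<in>A-B. u i powr s) = (\<Sum>i\<in>A-B. min (u i) (u i powr s))"
  proof (intro sum.cong refl)
    fix i assume i: "i \<in> A - B"
    then have "u i powr s \<le> u i"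
      using powr_mono[of s 1 "u i"] s A by (auto simp: B_def)
    then show "u i powr s = min (u i) (u i powr s)" by simp
  qed
  finally show ?thesis by (simp add: split[of "\<lambda>i. min (u i) (u i powr s)"])
qed

section \<open>Random dilations\<close>

text \<open>The left side is the exponential Markov bound at l = e / (4 q) for a dilation exceeding
  n (1 + e). By - ln (1 - x) <= x + 2 x^2 at x = e / 4 the linear terms cancel and n (- e^2 / 4 +
  e^2 / 8) / q remains; the part with k adds at most 1.\<close>

lemma chernoff_exponent_upper:
  fixes q e :: real
  assumes q: "q \<ge> 1" and e: "0 < e" "e \<le> 1" and k: "0 \<le> k" "k \<le> 1"
  shows "exp (- (e / (4 * q)) * (n * (1 + e))) * (1 - e / (4 * q) * q) powr (- (n / q + k))
     \<le> exp (1 - e\<^sup>2 / (8 * q) * real n)"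
proof -
  have "(1 - e / (4 * q) * q) powr (- (n / q + k)) = exp (- (n / q + k) * ln (1 - e / 4))"
    using q e by (simp add: powr_def)
  also have "\<dots> \<le> exp ((n / q + k) * (e / 4 + 2 * (e / 4)\<^sup>2))"
  proof -
    have "- ln (1 - e / 4) \<le> e / 4 + 2 * (e / 4)\<^sup>2"
      using ln_one_minus_pos_lower_bound[of "e/4"] e by simp
    then have "(n / q + k) * (- ln (1 - e / 4)) \<le> (n / q + k) * (e / 4 + 2 * (e / 4)\<^sup>2)"
      using q k by (intro mult_left_mono) auto
    moreover have "- (n / q + k) * ln (1 - e / 4) = (n / q + k) * (- ln (1 - e / 4))"
      by (simp add: algebra_simps)
    ultimately show ?thesis by (simp only: exp_le_cancel_iff)
  qed
  also have "\<dots> \<le> exp (1 + n / q * (e / 4 + 2 * (e / 4)\<^sup>2))"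
  proof -
    have "e\<^sup>2 \<le> 1" using e by (simp add: power_le_one)
    then have "e / 4 + 2 * (e / 4)\<^sup>2 \<le> 1" "0 \<le> e / 4 + 2 * (e / 4)\<^sup>2"
      using e by (auto simp: power_divide)
    then have "k * (e / 4 + 2 * (e / 4)\<^sup>2) \<le> 1"
      using k by (simp add: mult_le_one)
    then show ?thesis unfolding distrib_right by simp
  qed
  finally have "exp (- (e / (4 * q)) * (n * (1 + e))) * (1 - e / (4 * q) * q) powr (- (n / q + k))
     \<le> exp (- (e / (4 * q)) * (n * (1 + e))) * exp (1 + n / q * (e / 4 + 2 * (e / 4)\<^sup>2))"
    by (intro mult_left_mono) auto
  also have "\<dots> = exp (1 - e\<^sup>2 / (8 * q) * real n)"
    unfolding exp_add[symmetric] using q by (simp add: field_simps power2_eq_square)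
  finally show ?thesis .
qed

text \<open>The same for a dilation below n (1 - e), with l = - e / (2 q): the linear terms cancel
  and n (- e^2 / 2 + e^2 / 4) / q remains. Here the part with k only lowers the bound.\<close>

lemma chernoff_exponent_lower:
  fixes q e :: real
  assumes q: "q \<ge> 1" and e: "0 < e" "e \<le> 1" and k: "0 \<le> k"
  shows "exp (e / (2 * q) * (n * (1 - e))) * (1 + e / (2 * q) * q) powr (- (n / q + k))
     \<le> exp (- (e\<^sup>2 / (4 * q)) * real n)"
proof -
  have "(1 + e / (2 * q) * q) powr (- (n / q + k)) = exp (- (n / q + k) * ln (1 + e / 2))"
    using q e by (simp add: powr_def)
  also have "\<dots> \<le> exp (- (n / q) * (e / 2 - (e / 2)\<^sup>2))"
  proof -
    have "e / 2 - (e / 2)\<^sup>2 \<le> ln (1 + e / 2)"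
      using ln_one_plus_pos_lower_bound[of "e/2"] e by simp
    then have "(n / q) * (e / 2 - (e / 2)\<^sup>2) \<le> (n / q) * ln (1 + e / 2)"
      using q k by (intro mult_left_mono) auto
    also have "\<dots> \<le> (n / q + k) * ln (1 + e / 2)"
      using k e by (intro mult_right_mono) auto
    finally show ?thesis by (simp add: algebra_simps)
  qed
  finally have "exp (e / (2 * q) * (n * (1 - e))) * (1 + e / (2 * q) * q) powr (- (n / q + k))
     \<le> exp (e / (2 * q) * (n * (1 - e))) * exp (- (n / q) * (e / 2 - (e / 2)\<^sup>2))"
    by (intro mult_left_mono) auto
  also have "\<dots> = exp (- (e\<^sup>2 / (4 * q)) * real n)"
    unfolding exp_add[symmetric] using q by (simp add: field_simps power2_eq_square)
  finally show ?thesis .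
qed

text \<open>A random dilation \<open>u\<close> with law \<open>\<nu>\<close>, concentrated near \<open>u = n\<close>, turns \<open>S\<close> into \<open>T\<close>. Both the
  uniform distribution on the ball and the marginal of the sphere arise as such an \<open>S\<close>
  (with \<open>k = 1\<close> and \<open>k = 0\<close>).\<close>

definition radial_mixture :: "nat \<Rightarrow> real \<Rightarrow> real measure \<Rightarrow> real measure \<Rightarrow> bool" where
  "radial_mixture n q S T \<longleftrightarrow> prob_space S \<and> sets S = sets borel \<and> prob_space T \<and> sets T = sets borel \<and>
     (\<exists>\<nu> k. prob_space \<nu> \<and> sets \<nu> = sets borel \<and> 0 \<le> k \<and> k \<le> 1 \<and>
        (AE u in \<nu>. 0 \<le> u) \<and>
        (\<forall>l. l * q < 1 \<longrightarrow>
           (\<integral>\<^sup>+u. ennreal (exp (l * u)) \<partial>\<nu>) = ennreal ((1 - l * q) powr (- (n / q + k)))) \<and>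
        (\<forall>f\<in>borel_measurable borel.
           (\<integral>\<^sup>+t. f t \<partial>T) = (\<integral>\<^sup>+u. (\<integral>\<^sup>+s. f (u powr (1 / q) * s) \<partial>S) \<partial>\<nu>)))"

text \<open>On the event u >= n (1 - e) the dilation multiplies \<bar>s\<bar>^q by at least n (1 -
  e). Keeping only this event in the mixture bounds a moment of S at tilt of order n by a moment of
  T at fixed tilt, up to the probability of the event.\<close>

lemma radial_mixture_exp_moment:
  assumes mix: "radial_mixture n q S T" and q: "q \<ge> 1" and e: "0 < e" "e \<le> 1" and a: "a \<ge> 0"
  shows "(\<integral>\<^sup>+s. ennreal (exp (a * (1 - e) * n * \<bar>s\<bar> powr q)) \<partial>S) * ennreal (1 - exp (- (e\<^sup>2 / (4 * q)) * n))
     \<le> (\<integral>\<^sup>+t. ennreal (exp (a * \<bar>t\<bar> powr q)) \<partial>T)"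
proof -
  obtain \<nu> k where nu: "prob_space \<nu>" and [measurable_cong]: "sets \<nu> = sets borel"
    and k: "0 \<le> k" "k \<le> 1" and pos: "AE u in \<nu>. 0 \<le> u"
    and mgf: "\<And>l. l * q < 1 \<Longrightarrow>
           (\<integral>\<^sup>+u. ennreal (exp (l * u)) \<partial>\<nu>) = ennreal ((1 - l * q) powr (- (n / q + k)))"
    and T: "\<And>f. f \<in> borel_measurable borel \<Longrightarrow>
           (\<integral>\<^sup>+t. f t \<partial>T) = (\<integral>\<^sup>+u. (\<integral>\<^sup>+s. f (u powr (1 / q) * s) \<partial>S) \<partial>\<nu>)"
    and S: "prob_space S" and [measurable_cong]: "sets S = sets borel"
    using mix unfolding radial_mixture_def by auto
  interpret nu: prob_space \<nu> by fact
  interpret S: prob_space S by fact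
  have [simp]: "space \<nu> = UNIV" using sets_eq_imp_space_eq[of \<nu> borel] \<open>sets \<nu> = sets borel\<close> by simp
  let ?x = "n * (1 - e)"
  have "emeasure \<nu> {..<?x} \<le> ennreal (exp (- (e\<^sup>2 / (4 * q)) * n))"
  proof -
    have "emeasure \<nu> {..<?x} = (\<integral>\<^sup>+u. indicator {..<?x} u \<partial>\<nu>)"
      by simp
    also have "\<dots> \<le> (\<integral>\<^sup>+u. ennreal (exp (e / (2 * q) * ?x)) * ennreal (exp (- (e / (2 * q)) * u)) \<partial>\<nu>)"
    proof (intro nn_integral_mono)
      fix u :: real
      show "indicator {..<?x} u \<le> ennreal (exp (e / (2 * q) * ?x)) * ennreal (exp (- (e / (2 * q)) * u))"
      proof (cases "u < ?x")
        case True
        then have "e / (2 * q) * u \<le> e / (2 * q) * ?x"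
          using e q by (intro mult_left_mono) auto
        then have "ennreal 1 \<le> ennreal (exp (e / (2 * q) * ?x + - (e / (2 * q)) * u))"
          by (intro ennreal_leI) simp
        then show ?thesis using True by (simp add: ennreal_mult'[symmetric] exp_add[symmetric])
      qed auto
    qed
    also have "\<dots> = ennreal (exp (e / (2 * q) * ?x) * (1 + e / (2 * q) * q) powr (- (n / q + k)))"
      using mgf[of "- (e / (2 * q))"] e q by (simp add: nn_integral_cmult ennreal_mult')
    also have "\<dots> \<le> ennreal (exp (- (e\<^sup>2 / (4 * q)) * n))"
      using chernoff_exponent_lower[OF q e k(1), of n] by (intro ennreal_leI) (simp add: mult.commute)
    finally show ?thesis .
  qed
  then have "nu.prob {..<?x} \<le> exp (- (e\<^sup>2 / (4 * q)) * n)"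
    by (simp add: nu.emeasure_eq_measure)
  moreover have "nu.prob {?x..} = 1 - nu.prob {..<?x}"
    using nu.prob_compl[of "{..<?x}"] by (simp add: Compl_eq_Diff_UNIV[symmetric] Compl_lessThan)
  ultimately have "ennreal (1 - exp (- (e\<^sup>2 / (4 * q)) * n)) \<le> emeasure \<nu> {?x..}"
    by (auto simp: nu.emeasure_eq_measure intro!: ennreal_leI)
  then have "(\<integral>\<^sup>+s. ennreal (exp (a * (1 - e) * n * \<bar>s\<bar> powr q)) \<partial>S) * ennreal (1 - exp (- (e\<^sup>2 / (4 * q)) * n))
     \<le> (\<integral>\<^sup>+s. ennreal (exp (a * (1 - e) * n * \<bar>s\<bar> powr q)) \<partial>S) * emeasure \<nu> {?x..}"
    by (intro mult_left_mono) auto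
  also have "\<dots> = (\<integral>\<^sup>+u. (\<integral>\<^sup>+s. ennreal (exp (a * (1 - e) * n * \<bar>s\<bar> powr q)) \<partial>S) * indicator {?x..} u \<partial>\<nu>)"
    by (simp add: nn_integral_cmult_indicator)
  also have "\<dots> \<le> (\<integral>\<^sup>+u. (\<integral>\<^sup>+s. ennreal (exp (a * \<bar>u powr (1 / q) * s\<bar> powr q)) \<partial>S) \<partial>\<nu>)"
  proof (intro nn_integral_mono)
    fix u :: real
    show "(\<integral>\<^sup>+s. ennreal (exp (a * (1 - e) * n * \<bar>s\<bar> powr q)) \<partial>S) * indicator {?x..} u
        \<le> (\<integral>\<^sup>+s. ennreal (exp (a * \<bar>u powr (1 / q) * s\<bar> powr q)) \<partial>S)"
    proof (cases "u \<ge> ?x")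
      case True
      have "?x \<ge> 0" using e by simp
      then have u: "u \<ge> 0" using True by linarith
      have "(\<integral>\<^sup>+s. ennreal (exp (a * (1 - e) * n * \<bar>s\<bar> powr q)) \<partial>S)
        \<le> (\<integral>\<^sup>+s. ennreal (exp (a * \<bar>u powr (1 / q) * s\<bar> powr q)) \<partial>S)"
      proof (intro nn_integral_mono ennreal_leI)
        fix s :: real
        have "\<bar>u powr (1 / q) * s\<bar> powr q = u * \<bar>s\<bar> powr q"
          using u q by (cases "u = 0") (simp_all add: abs_mult powr_mult powr_powr)
        moreover have "a * (?x * \<bar>s\<bar> powr q) \<le> a * (u * \<bar>s\<bar> powr q)"
          using True a by (intro mult_left_mono mult_right_mono) auto
        ultimately show "exp (a * (1 - e) * n * \<bar>s\<bar> powr q) \<le> exp (a * \<bar>u powr (1 / q) * s\<bar> powr q)"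
          by (simp add: mult_ac)
      qed
      then show ?thesis using True by simp
    qed simp
  qed
  also have "\<dots> = (\<integral>\<^sup>+t. ennreal (exp (a * \<bar>t\<bar> powr q)) \<partial>T)"
    by (rule T[symmetric]) measurable
  finally show ?thesis .
qed

text \<open>If u <= n (1 + e), then T can exceed the threshold only if S exceeds x. For larger u the
  exponential Markov majorant is at least 1, and its integral is the second term.\<close>

lemma radial_mixture_tail:
  assumes mix: "radial_mixture n q S T" and q: "q \<ge> 1" and e: "0 < e" "e \<le> 1" and x: "x > 0" and n: "n > 0"
  shows "emeasure T {x * (n * (1 + e)) powr (1 / q)..}
     \<le> emeasure S {x..} + ennreal (exp (1 - e\<^sup>2 / (8 * q) * n))"
proof -
  obtain \<nu> k where nu: "prob_space \<nu>" and [measurable_cong]: "sets \<nu> = sets borel"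
    and k: "0 \<le> k" "k \<le> 1" and pos: "AE u in \<nu>. 0 \<le> u"
    and mgf: "\<And>l. l * q < 1 \<Longrightarrow>
           (\<integral>\<^sup>+u. ennreal (exp (l * u)) \<partial>\<nu>) = ennreal ((1 - l * q) powr (- (n / q + k)))"
    and T: "\<And>f. f \<in> borel_measurable borel \<Longrightarrow>
           (\<integral>\<^sup>+t. f t \<partial>T) = (\<integral>\<^sup>+u. (\<integral>\<^sup>+s. f (u powr (1 / q) * s) \<partial>S) \<partial>\<nu>)"
    and S: "prob_space S" and [measurable_cong]: "sets S = sets borel" "sets T = sets borel"
    using mix unfolding radial_mixture_def by auto
  interpret nu: prob_space \<nu> by fact
  interpret S: prob_space S by fact
  let ?y = "n * (1 + e)" and ?l = "e / (4 * q)"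
  let ?X = "x * ?y powr (1 / q)"
  have "emeasure T {?X..} = (\<integral>\<^sup>+t. indicator {?X..} t \<partial>T)"
    by simp
  also have "\<dots> = (\<integral>\<^sup>+u. (\<integral>\<^sup>+s. indicator {?X..} (u powr (1 / q) * s) \<partial>S) \<partial>\<nu>)"
    by (rule T) simp
  also have "\<dots> \<le> (\<integral>\<^sup>+u. emeasure S {x..} + ennreal (exp (- ?l * ?y)) * ennreal (exp (?l * u)) \<partial>\<nu>)"
  proof (rule nn_integral_mono_AE, rule AE_mp[OF pos], intro AE_I2 impI)
    fix u :: real
    assume u: "0 \<le> u"
    show "(\<integral>\<^sup>+s. indicator {?X..} (u powr (1 / q) * s) \<partial>S)
       \<le> emeasure S {x..} + ennreal (exp (- ?l * ?y)) * ennreal (exp (?l * u))"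
    proof (cases "u \<le> ?y")
      case True
      have "(\<integral>\<^sup>+s. indicator {?X..} (u powr (1 / q) * s) \<partial>S) \<le> (\<integral>\<^sup>+s. indicator {x..} s \<partial>S)"
      proof (intro nn_integral_mono)
        fix s :: real
        have "x \<le> s" if "?X \<le> u powr (1 / q) * s"
        proof -
          have y: "?y powr (1 / q) > 0" using n e by simp
          \<comment> \<open>Positivity of s has to come first: the comparison of the two dilations
            can be multiplied only by a nonnegative s.\<close>
          then have "0 < u powr (1 / q) * s" using that x by (smt (verit) mult_pos_pos)
          then have s: "s > 0"
            by (simp add: zero_less_mult_iff)
          have "u powr (1 / q) \<le> ?y powr (1 / q)"
            using True u q by (intro powr_mono2) auto
          then have "u powr (1 / q) * s \<le> ?y powr (1 / q) * s"
            using s by (intro mult_right_mono) auto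
          with that have "?y powr (1 / q) * x \<le> ?y powr (1 / q) * s"
            by (simp add: mult.commute)
          then show ?thesis using y by simp
        qed
        then show "(indicator {?X..} (u powr (1 / q) * s) :: ennreal) \<le> indicator {x..} s"
          by (auto simp: indicator_def)
      qed
      also have "\<dots> = emeasure S {x..}" by simp
      finally show ?thesis by (meson add_increasing2 zero_le order_trans)
    next
      case False
      then have "?l * ?y \<le> ?l * u"
        using e q by (intro mult_left_mono) auto
      then have "ennreal 1 \<le> ennreal (exp (- ?l * ?y + ?l * u))"
        by (intro ennreal_leI) simp
      moreover have "(\<integral>\<^sup>+s. indicator {?X..} (u powr (1 / q) * s) \<partial>S) \<le> (\<integral>\<^sup>+s. 1 \<partial>S)"
        by (intro nn_integral_mono) (auto simp: indicator_def)
      ultimately show ?thesis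
        unfolding exp_add by (simp add: ennreal_mult' S.emeasure_space_1 add_increasing order_trans)
    qed
  qed
  also have "\<dots> = emeasure S {x..} + ennreal (exp (- ?l * ?y) * (1 - ?l * q) powr (- (n / q + k)))"
    using mgf[of ?l] e q by (simp add: nn_integral_add nn_integral_cmult ennreal_mult' nu.emeasure_space_1)
  also have "\<dots> \<le> emeasure S {x..} + ennreal (exp (1 - e\<^sup>2 / (8 * q) * n))"
    using chernoff_exponent_upper[OF q e k, of n] by (intro add_left_mono ennreal_leI) simp
  finally show ?thesis .
qed

section \<open>The Euclidean norm of a uniform point of the ball\<close>

definition norm_Rn :: "nat \<Rightarrow> (nat \<Rightarrow> real) \<Rightarrow> real" where
  "norm_Rn n x = sqrt (\<Sum>i=1..n. (x i)\<^sup>2)"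

lemma norm_Rn_nonneg [simp]: "norm_Rn n x \<ge> 0"
  by (simp add: norm_Rn_def sum_nonneg)

lemma measurable_norm_Rn [measurable]: "norm_Rn n \<in> borel_measurable (borel_Rn n)"
  unfolding norm_Rn_def by measurable

lemma sets_PiM_pgauss [measurable_cong]: "sets (PiM {1..n} (\<lambda>_. pgauss q)) = sets (borel_Rn n)"
  by (intro sets_PiM_cong) auto

lemma prob_space_PiM_pgauss:
  fixes n :: nat
  shows "q \<ge> 1 \<Longrightarrow> prob_space (PiM {1..n} (\<lambda>_. pgauss q))"
  by (intro prob_space_PiM prob_space_pgauss)

text \<open>The Euclidean norm is homogeneous of degree one, so the representation of the vector by
  dilated balls passes to the law of its norm.\<close>

lemma radial_mixture_lp_ball:
  assumes p: "p \<ge> 1" and \<mu>: "prob_space (uniform_measure (lebesgue_Rn n) (lp_ball n p))"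
  shows "radial_mixture n p (distr (uniform_measure (lebesgue_Rn n) (lp_ball n p)) borel (norm_Rn n))
           (distr (PiM {1..n} (\<lambda>_. pgauss p)) borel (norm_Rn n))"
proof -
  let ?\<mu> = "uniform_measure (lebesgue_Rn n) (lp_ball n p)" and ?G = "PiM {1..n} (\<lambda>_. pgauss p)"
  interpret mu: prob_space ?\<mu> by fact
  interpret G: prob_space ?G by (rule prob_space_PiM_pgauss[OF p])
  have [measurable_cong]: "sets ?\<mu> = sets (borel_Rn n)"
    by (simp add: sets_lebesgue_Rn del: One_nat_def)
  let ?B = "emeasure (lebesgue_Rn n) (lp_ball n p)"
  \<comment> \<open>Read off from the assumption that the normalised measure is a probability: with
    volume 0 or infinity its total mass would be 0.\<close>
  have B: "?B \<noteq> 0" "?B \<noteq> \<top>"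
    using mu.emeasure_space_1 by (auto simp: uniform_measure_def emeasure_density
      nn_integral_divide ennreal_top_eq_mult_iff simp del: One_nat_def)
  define v where "v = enn2real ?B"
  have v: "?B = ennreal v" "v > 0"
    using B by (auto simp: v_def enn2real_positive_iff less_top zero_less_iff_neq_zero)
  define K where "K = v / (p * pgauss_const p ^ n)"
  have K: "K > 0" using v p pgauss_const[OF p] by (simp add: K_def)
  \<comment> \<open>An unnormalised Gamma density of shape n/p + 1 and scale p; the summand 1 in the
    shape is the value k = 1 of the mixture.\<close>
  define \<phi> where "\<phi> u = ennreal (exp (- (u / p)) * u powr (n / p)) * indicator {0<..} u" for u :: real
  have [measurable]: "\<phi> \<in> borel_measurable borel" unfolding \<phi>_def by measurable
  define \<nu> where "\<nu> = density lborel (\<lambda>u. ennreal K * \<phi> u)"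
  have [measurable_cong]: "sets \<nu> = sets borel" by (simp add: \<nu>_def)
  have G: "(\<integral>\<^sup>+y. f y \<partial>?G) = (\<integral>\<^sup>+u. (\<integral>\<^sup>+x. f (\<lambda>i\<in>{1..n}. u powr (1 / p) * x i) \<partial>?\<mu>) \<partial>\<nu>)"
    if [measurable]: "f \<in> borel_measurable (borel_Rn n)" for f
  proof -
    have "(\<integral>\<^sup>+x. f (\<lambda>i\<in>{1..n}. u powr (1 / p) * x i) * indicator (lp_ball n p) x \<partial>lebesgue_Rn n)
       = ennreal v * (\<integral>\<^sup>+x. f (\<lambda>i\<in>{1..n}. u powr (1 / p) * x i) \<partial>?\<mu>)" for u
    proof -
      have [measurable]: "lp_ball n p \<in> sets (lebesgue_Rn n)"
        unfolding sets_lebesgue_Rn by measurable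
      show ?thesis
        by (subst nn_integral_uniform_measure)
          (use B in \<open>auto simp: v(1)[symmetric] ennreal_times_divide ennreal_mult_divide_eq mult.commute[of ?B]
             simp del: One_nat_def\<close>)
    qed
    note eq = this
    have k: "ennreal (exp (- (u / p)) * u powr (n / p) / (p * pgauss_const p ^ n)) * indicator {0<..} u * (ennreal v * I)
       = ennreal K * \<phi> u * I" for u I
    proof -
      have "ennreal (exp (- (u / p)) * u powr (n / p) / (p * pgauss_const p ^ n)) * ennreal v
          = ennreal K * ennreal (exp (- (u / p)) * u powr (n / p))"
        using v K p pgauss_const[OF p] by (simp add: ennreal_mult'[symmetric] ennreal_mult''[symmetric] K_def mult.commute)
      moreover have "a * i * (ennreal v * I) = (a * ennreal v) * (i * I)" for a i :: ennreal
        by (simp only: ac_simps)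
      ultimately have "ennreal (exp (- (u / p)) * u powr (n / p) / (p * pgauss_const p ^ n)) * indicator {0<..} u * (ennreal v * I)
          = ennreal K * ennreal (exp (- (u / p)) * u powr (n / p)) * (indicator {0<..} u * I)"
        by (simp only:)
      then show ?thesis by (simp only: \<phi>_def mult.assoc)
    qed
    have "(\<lambda>ux. \<lambda>i\<in>{1..n}. fst ux powr (1 / p) * snd ux i) \<in> measurable (borel \<Otimes>\<^sub>M ?\<mu>) (borel_Rn n)"
      by (intro measurable_restrict) measurable
    then have "(\<lambda>(u, x). f (\<lambda>i\<in>{1..n}. u powr (1 / p) * x i)) \<in> borel_measurable (borel \<Otimes>\<^sub>M ?\<mu>)"
      unfolding split_beta by (rule measurable_compose[OF _ that])
    then have [measurable]: "(\<lambda>u. \<integral>\<^sup>+x. f (\<lambda>i\<in>{1..n}. u powr (1 / p) * x i) \<partial>?\<mu>) \<in> borel_measurable borel"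
      by (rule mu.borel_measurable_nn_integral)
    show ?thesis
      unfolding nn_integral_pgauss_layers[OF p that] eq k \<nu>_def
      by (rule nn_integral_density[symmetric]) measurable
  qed
  \<comment> \<open>The mixture formula applied to f = 1 shows that K is the right normalising
    constant.\<close>
  have nu1: "emeasure \<nu> (space \<nu>) = 1"
    using G[of "\<lambda>_. 1"] G.emeasure_space_1 mu.emeasure_space_1 by simp
  have nu: "prob_space \<nu>"
    by standard (rule nu1)
  have one: "ennreal K * (\<integral>\<^sup>+u. \<phi> u \<partial>lborel) = 1"
    using nu1 by (simp add: \<nu>_def emeasure_density nn_integral_cmult)
  have mgf: "(\<integral>\<^sup>+u. ennreal (exp (l * u)) \<partial>\<nu>) = ennreal ((1 - l * p) powr (- (n / p + 1)))"
    if l: "l * p < 1" for l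
  proof -
    \<comment> \<open>Replacing u by t u turns exp (- u / p) into its tilt by exp (l u). The power
      in the density yields t^(n/p), and the Jacobian supplies the remaining factor t.\<close>
    define t where "t = 1 - l * p"
    have t: "t > 0" using l by (simp add: t_def)
    have "1 = ennreal K * (ennreal t * (\<integral>\<^sup>+u. \<phi> (t * u) \<partial>lborel))"
      using nn_integral_real_affine[of \<phi> t 0] t one by simp
    also have "(\<lambda>u. \<phi> (t * u)) = (\<lambda>u. ennreal (t powr (n / p)) * (\<phi> u * ennreal (exp (l * u))))"
    proof
      fix u :: real
      show "\<phi> (t * u) = ennreal (t powr (n / p)) * (\<phi> u * ennreal (exp (l * u)))"
      proof (cases "u > 0")
        case True
        have "exp (- (t * u / p)) = exp (- (u / p)) * exp (l * u)"
          unfolding exp_add[symmetric] t_def using p by (simp add: field_simps)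
        then have "exp (- (t * u / p)) * (t * u) powr (n / p)
            = t powr (n / p) * (exp (- (u / p)) * u powr (n / p) * exp (l * u))"
          using True t by (simp add: powr_mult)
        then show ?thesis
          using True t by (simp add: \<phi>_def ennreal_mult'[symmetric])
      qed (use t in \<open>auto simp: \<phi>_def zero_less_mult_iff\<close>)
    qed
    also have "ennreal K * (ennreal t * (\<integral>\<^sup>+u. ennreal (t powr (n / p)) * (\<phi> u * ennreal (exp (l * u))) \<partial>lborel))
       = ennreal (t powr (n / p + 1)) * (ennreal K * (\<integral>\<^sup>+u. \<phi> u * ennreal (exp (l * u)) \<partial>lborel))"
    proof -
      have "ennreal (t powr (n / p + 1)) = ennreal t * ennreal (t powr (n / p))"
        using t by (simp add: ennreal_mult'[symmetric] powr_add mult.commute)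
      then show ?thesis by (subst nn_integral_cmult) (auto simp: ac_simps)
    qed
    also have "ennreal K * (\<integral>\<^sup>+u. \<phi> u * ennreal (exp (l * u)) \<partial>lborel) = (\<integral>\<^sup>+u. ennreal (exp (l * u)) \<partial>\<nu>)"
      unfolding \<nu>_def by (subst nn_integral_density) (auto simp: nn_integral_cmult mult.assoc)
    finally have *: "ennreal (t powr (n / p + 1)) * (\<integral>\<^sup>+u. ennreal (exp (l * u)) \<partial>\<nu>) = 1" ..
    have "(\<integral>\<^sup>+u. ennreal (exp (l * u)) \<partial>\<nu>)
       = ennreal (t powr (- (n / p + 1))) * (ennreal (t powr (n / p + 1)) * (\<integral>\<^sup>+u. ennreal (exp (l * u)) \<partial>\<nu>))"
      using t by (simp add: mult.assoc[symmetric] ennreal_mult'[symmetric] powr_add[symmetric])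
    then show ?thesis unfolding * by (simp add: t_def)
  qed
  have pos: "AE u in \<nu>. 0 \<le> u"
    unfolding \<nu>_def by (subst AE_density) (auto simp: \<phi>_def indicator_def)
  have mix: "(\<integral>\<^sup>+t. f t \<partial>distr ?G borel (norm_Rn n))
      = (\<integral>\<^sup>+u. (\<integral>\<^sup>+s. f (u powr (1 / p) * s) \<partial>distr ?\<mu> borel (norm_Rn n)) \<partial>\<nu>)"
    if [measurable]: "f \<in> borel_measurable borel" for f
  proof -
    have "norm_Rn n (\<lambda>i\<in>{1..n}. c * x i) = c * norm_Rn n x" if "c \<ge> 0" for c x
    proof -
      have "(\<Sum>i=1..n. ((\<lambda>i\<in>{1..n}. c * x i) i)\<^sup>2) = c\<^sup>2 * (\<Sum>i=1..n. (x i)\<^sup>2)"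
        by (simp add: power_mult_distrib sum_distrib_left)
      then show ?thesis using that by (simp add: norm_Rn_def real_sqrt_mult)
    qed
    then show ?thesis
      by (simp add: nn_integral_distr G del: One_nat_def)
  qed
  have "prob_space (distr ?\<mu> borel (norm_Rn n))" "prob_space (distr ?G borel (norm_Rn n))"
    by (intro mu.prob_space_distr G.prob_space_distr; measurable)+
  then show ?thesis
    unfolding radial_mixture_def
    using nu mgf pos mix
    by (auto intro!: exI[of _ \<nu>] exI[of _ 1] simp del: One_nat_def simp: \<open>sets \<nu> = sets borel\<close>)
qed

text \<open>After truncation the exponent is b n^(p/2) plus a sum of independent terms g(y_i). Since
  g(y) <= d y^2 with n d = b n^(p/2), each factor is 1 + O(d), and n of them multiply to exp
  (O(n^(p/2))). The other bound g(y) <= b \<bar>y\<bar>^p keeps each factor finite.\<close>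

lemma pgauss_norm_exp_moment:
  assumes p: "1 \<le> p" "p < 2" and e: "0 < e" "e \<le> 1"
  shows "\<exists>C. \<forall>n\<ge>1. (\<integral>\<^sup>+y. ennreal (exp ((1 - e) / p * norm_Rn n y powr p)) \<partial>PiM {1..n} (\<lambda>_. pgauss p))
      \<le> ennreal (exp (C * n powr (p / 2)))"
proof -
  define b where "b = (1 - e) / p"
  have b: "b \<ge> 0" using p e by (simp add: b_def)
  obtain K where K: "K \<ge> 0" "(\<integral>\<^sup>+y. ennreal (y\<^sup>2 * exp (b * \<bar>y\<bar> powr p)) \<partial>pgauss p) \<le> ennreal K"
    using pgauss_square_exp_finite[OF p(1) e] unfolding b_def by auto
  interpret prob_space "pgauss p" by (rule prob_space_pgauss[OF p(1)])
  interpret G: product_sigma_finite "\<lambda>_::nat. pgauss p" by standard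
  show ?thesis
  proof (intro exI[of _ "b + b * K"] allI impI)
    fix n :: nat
    assume n: "n \<ge> 1"
    let ?N = "real n powr (p / 2)"
    define d where "d = b * real n powr (p / 2 - 1)"
    have d: "d \<ge> 0" "n * d = b * ?N"
      using b n by (auto simp: d_def powr_diff)
    define g where "g y = b * ?N * min (y\<^sup>2 / n) ((y\<^sup>2 / n) powr (p / 2))" for y :: real
    have [measurable]: "g \<in> borel_measurable borel"
      unfolding g_def by measurable
    have g0: "g y \<ge> 0" for y
      using b by (simp add: g_def)
    have g1: "g y \<le> d * y\<^sup>2" for y
    proof -
      have "g y \<le> b * ?N * (y\<^sup>2 / n)"
        unfolding g_def using b by (intro mult_left_mono) auto
      also have "\<dots> = d * y\<^sup>2"
        using n by (simp add: d_def powr_diff)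
      finally show ?thesis .
    qed
    have g2: "g y \<le> b * \<bar>y\<bar> powr p" for y
    proof -
      have "g y \<le> b * ?N * (y\<^sup>2 / n) powr (p / 2)"
        unfolding g_def using b by (intro mult_left_mono) auto
      also have "(y\<^sup>2 / n) powr (p / 2) = \<bar>y\<bar> powr p / ?N"
      proof -
        have "(y\<^sup>2) powr (p / 2) = \<bar>y\<bar> powr p"
          using powr_powr[of "\<bar>y\<bar>" 2 "p / 2"] by (cases "y = 0") auto
        then show ?thesis using n by (simp add: powr_divide)
      qed
      finally show ?thesis using n by simp
    qed
    have one: "(\<integral>\<^sup>+y. ennreal (exp (g y)) \<partial>pgauss p) \<le> ennreal (exp (d * K))"
    proof -
      have "(\<integral>\<^sup>+y. ennreal (exp (g y)) \<partial>pgauss p)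
          \<le> (\<integral>\<^sup>+y. 1 + ennreal d * ennreal (y\<^sup>2 * exp (b * \<bar>y\<bar> powr p)) \<partial>pgauss p)"
      proof (intro nn_integral_mono)
        fix y :: real
        \<comment> \<open>In exp g <= 1 + g exp g the two bounds on g are used in different places:
          d y^2 for the factor, so that the small d comes out in front, and b \<bar>y\<bar>^p in the
          exponent, so that the integral stays bounded by K.\<close>
        have "1 - g y \<le> exp (- g y)"
          using exp_ge_add_one_self[of "- g y"] by simp
        then have "(1 - g y) * exp (g y) \<le> exp (- g y) * exp (g y)"
          by (intro mult_right_mono) auto
        then have "exp (g y) \<le> 1 + g y * exp (g y)"
          by (simp add: exp_add[symmetric] algebra_simps)
        also have "\<dots> \<le> 1 + (d * y\<^sup>2) * exp (b * \<bar>y\<bar> powr p)"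
          using g0 g1 g2 d by (intro add_left_mono mult_mono) auto
        finally show "ennreal (exp (g y)) \<le> 1 + ennreal d * ennreal (y\<^sup>2 * exp (b * \<bar>y\<bar> powr p))"
          using d by (simp add: ennreal_mult'[symmetric] mult.assoc ennreal_leI flip: ennreal_1 ennreal_plus)
      qed
      also have "\<dots> = 1 + ennreal d * (\<integral>\<^sup>+y. ennreal (y\<^sup>2 * exp (b * \<bar>y\<bar> powr p)) \<partial>pgauss p)"
        using emeasure_space_1 by (simp add: nn_integral_add nn_integral_cmult)
      also have "\<dots> \<le> 1 + ennreal d * ennreal K"
        by (intro add_left_mono mult_left_mono K) auto
      also have "\<dots> = ennreal (1 + d * K)"
        using d K by (simp add: ennreal_mult')
      also have "\<dots> \<le> ennreal (exp (d * K))"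
        by (intro ennreal_leI) (rule exp_ge_add_one_self)
      finally show ?thesis .
    qed
    have "(\<integral>\<^sup>+y. ennreal (exp (b * norm_Rn n y powr p)) \<partial>PiM {1..n} (\<lambda>_. pgauss p))
       \<le> (\<integral>\<^sup>+y. ennreal (exp (b * ?N)) * (\<Prod>i\<in>{1..n}. ennreal (exp (g (y i)))) \<partial>PiM {1..n} (\<lambda>_. pgauss p))"
    proof (intro nn_integral_mono)
      fix y
      have "norm_Rn n y powr p = (\<Sum>i=1..n. (y i)\<^sup>2) powr (p / 2)"
        by (simp add: norm_Rn_def powr_half_sqrt[symmetric] powr_powr sum_nonneg)
      also have "\<dots> = ?N * (\<Sum>i=1..n. (y i)\<^sup>2 / n) powr (p / 2)"
        using n by (simp add: sum_divide_distrib[symmetric] powr_divide sum_nonneg)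
      also have "\<dots> \<le> ?N * (1 + (\<Sum>i=1..n. min ((y i)\<^sup>2 / n) (((y i)\<^sup>2 / n) powr (p / 2))))"
        using p by (intro mult_left_mono sum_powr_le_truncated) auto
      finally have "b * norm_Rn n y powr p \<le> b * (?N * (1 + (\<Sum>i=1..n. min ((y i)\<^sup>2 / n) (((y i)\<^sup>2 / n) powr (p / 2)))))"
        using b by (intro mult_left_mono) auto
      also have "\<dots> = b * ?N + (\<Sum>i=1..n. g (y i))"
        by (simp add: g_def sum_distrib_left algebra_simps)
      finally have "ennreal (exp (b * norm_Rn n y powr p)) \<le> ennreal (exp (b * ?N + (\<Sum>i=1..n. g (y i))))"
        by (simp add: ennreal_leI)
      then show "ennreal (exp (b * norm_Rn n y powr p)) \<le> ennreal (exp (b * ?N)) * (\<Prod>i\<in>{1..n}. ennreal (exp (g (y i))))"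
        by (simp add: exp_add exp_sum prod_ennreal ennreal_mult')
    qed
    also have "\<dots> = ennreal (exp (b * ?N)) * (\<Prod>i\<in>{1..n}. \<integral>\<^sup>+t. ennreal (exp (g t)) \<partial>pgauss p)"
      by (subst nn_integral_cmult; (subst G.product_nn_integral_prod)?; simp?) measurable
    also have "\<dots> \<le> ennreal (exp (b * ?N)) * (\<Prod>i\<in>{1..n}. ennreal (exp (d * K)))"
      using one by (auto intro: mult_left_mono power_mono_ennreal)
    also have "\<dots> = ennreal (exp ((b + b * K) * ?N))"
      using d(2) by (simp add: ennreal_power ennreal_mult'[symmetric] exp_of_nat_mult[symmetric] exp_add[symmetric])
        (simp add: algebra_simps flip: mult.assoc)
    finally show "(\<integral>\<^sup>+y. ennreal (exp ((1 - e) / p * norm_Rn n y powr p)) \<partial>PiM {1..n} (\<lambda>_. pgauss p))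
      \<le> ennreal (exp ((b + b * K) * n powr (p / 2)))"
      unfolding b_def .
  qed
qed

section \<open>Marginals of the sphere\<close>

text \<open>A Householder reflection exchanging \<open>x\<close> with a multiple of the first basis vector.\<close>

lemma exists_orthogonal_first_row:
  assumes n: "n \<ge> 1"
  shows "\<exists>A. orthogonal_mat n A \<and> (\<forall>j\<in>{1..n}. norm_Rn n x * A 1 j = x j)"
proof -
  define \<rho> where "\<rho> = norm_Rn n x"
  define \<delta> :: "nat \<Rightarrow> nat \<Rightarrow> real" where "\<delta> i j = (if i = j then 1 else 0)" for i j
  define v where "v i = \<delta> 1 i - x i / \<rho>" for i
  define s where "s = (\<Sum>i=1..n. (v i)\<^sup>2)"
  \<comment> \<open>Division by 0 gives 0, which covers the degenerate cases. If x is already a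
    nonnegative multiple of the first basis vector and nonzero, then v = 0, c = 0 and A is the
    identity; if x = 0, then v is that basis vector.\<close>
  define c where "c = 2 / s"
  define A where "A k i = \<delta> k i - c * v k * v i" for k i
  have \<delta>sum: "(\<Sum>k=1..n. \<delta> k i * f k) = f i" if "i \<in> {1..n}" for i f
    unfolding \<delta>_def using that by (simp add: if_distrib[of "\<lambda>a. a * _"] cong: if_cong)
  have "orthogonal_mat n A"
    unfolding orthogonal_mat_def
  proof (intro ballI)
    fix i j assume ij: "i \<in> {1..n}" "j \<in> {1..n}"
    have "(\<Sum>k=1..n. A k i * A k j)
       = (\<Sum>k=1..n. \<delta> k i * (\<delta> k j - c * v k * v j)) - c * v i * (\<Sum>k=1..n. \<delta> k j * v k)
          + c * c * v i * v j * (\<Sum>k=1..n. (v k)\<^sup>2)"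
      unfolding A_def sum_distrib_left sum_subtractf[symmetric] sum.distrib[symmetric]
      by (intro sum.cong refl) (simp add: algebra_simps power2_eq_square)
    also have "\<dots> = \<delta> i j - 2 * c * v i * v j + (c * c * s) * v i * v j"
      unfolding \<delta>sum[OF ij(1)] \<delta>sum[OF ij(2)] s_def by (simp add: algebra_simps)
    also have "c * c * s = 2 * c"
      by (simp add: c_def)
    finally show "(\<Sum>k=1..n. A k i * A k j) = (if i = j then 1 else 0)"
      by (simp add: \<delta>_def)
  qed
  moreover have "norm_Rn n x * A 1 j = x j" if j: "j \<in> {1..n}" for j
  proof (cases "\<rho> = 0")
    case True
    then have "(\<Sum>i=1..n. (x i)\<^sup>2) = 0" by (simp add: \<rho>_def norm_Rn_def)
    then have "x j = 0" using j by (subst (asm) sum_nonneg_eq_0_iff) auto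
    then show ?thesis using True by (simp add: \<rho>_def)
  next
    case False
    have sq: "(\<Sum>i=1..n. (x i)\<^sup>2) = \<rho>\<^sup>2" by (simp add: \<rho>_def norm_Rn_def sum_nonneg)
    \<comment> \<open>The squared distance of the unit vectors e_1 and x / \<rho> is 2 (1 - x_1 /
      \<rho>) = 2 v_1. Hence c v_1 = 1 unless s = 0, and the first row of A is e_1 - v = x /
      \<rho>.\<close>
    have "s = (\<Sum>i=1..n. \<delta> i 1 * \<delta> i 1) - 2 / \<rho> * (\<Sum>i=1..n. \<delta> i 1 * x i) + (\<Sum>i=1..n. (x i)\<^sup>2) / \<rho>\<^sup>2"
      unfolding s_def v_def sum_distrib_left sum_divide_distrib sum_subtractf[symmetric] sum.distrib[symmetric]
      using False by (intro sum.cong refl) (auto simp: \<delta>_def field_simps power2_eq_square)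
    also have "\<dots> = 2 - 2 * x 1 / \<rho>"
      using n False by (subst (1 2) \<delta>sum) (auto simp: sq \<delta>_def simp del: One_nat_def)
    finally have s: "s = 2 * v 1" by (simp add: v_def \<delta>_def)
    have "A 1 j = x j / \<rho>"
    proof (cases "s = 0")
      case True
      then have "v j = 0" using j unfolding s_def by (subst (asm) sum_nonneg_eq_0_iff) auto
      then show ?thesis by (simp add: A_def v_def)
    next
      case False
      then have "c * v 1 = 1" using s by (simp add: c_def)
      then show ?thesis by (simp add: A_def v_def)
    qed
    then show ?thesis using False by (simp add: \<rho>_def)
  qed
  ultimately show ?thesis by blast
qed

lemma measurable_mat_apply [measurable]: "mat_apply n A \<in> measurable (borel_Rn n) (borel_Rn n)"
  unfolding mat_apply_def by (intro measurable_restrict) measurable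

text \<open>A rotation whose first row is x / \<bar>x\<bar> sends the first coordinate of \<theta>
  to the normalised inner product, and the law of \<theta> does not notice the rotation.\<close>

lemma nn_integral_sphere_inner:
  assumes \<sigma>: "rotation_invariant_sphere_prob n \<sigma>" and n: "n \<ge> 1"
    and f [measurable]: "f \<in> borel_measurable borel"
  shows "(\<integral>\<^sup>+\<theta>. f (\<Sum>i=1..n. x i * \<theta> i) \<partial>\<sigma>) = (\<integral>\<^sup>+\<theta>. f (norm_Rn n x * \<theta> 1) \<partial>\<sigma>)"
proof -
  have sets: "sets \<sigma> = sets (borel_Rn n)"
    and inv: "\<And>A. orthogonal_mat n A \<Longrightarrow> distr \<sigma> (borel_Rn n) (mat_apply n A) = \<sigma>"
    using \<sigma> by (auto simp: rotation_invariant_sphere_prob_def)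
  obtain A where A: "orthogonal_mat n A" "\<And>j. j \<in> {1..n} \<Longrightarrow> norm_Rn n x * A 1 j = x j"
    using exists_orthogonal_first_row[OF n] by blast
  have 1: "1 \<in> {1..n}" using n by simp
  have m: "(\<lambda>\<theta>. f (norm_Rn n x * \<theta> 1)) \<in> borel_measurable (borel_Rn n)"
    using 1 by measurable
  have "(\<integral>\<^sup>+\<theta>. f (norm_Rn n x * \<theta> 1) \<partial>\<sigma>) = (\<integral>\<^sup>+\<theta>. f (norm_Rn n x * \<theta> 1) \<partial>distr \<sigma> (borel_Rn n) (mat_apply n A))"
    by (simp only: inv[OF A(1)])
  also have "\<dots> = (\<integral>\<^sup>+\<theta>. f (norm_Rn n x * mat_apply n A \<theta> 1) \<partial>\<sigma>)"
    using m measurable_mat_apply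
    by (intro nn_integral_distr) (simp_all only: measurable_cong_sets[OF sets refl] measurable_distr_eq1)
  also have "(\<lambda>\<theta>. norm_Rn n x * mat_apply n A \<theta> 1) = (\<lambda>\<theta>. \<Sum>i=1..n. x i * \<theta> i)"
  proof
    fix \<theta>
    have "norm_Rn n x * mat_apply n A \<theta> 1 = (\<Sum>i=1..n. (norm_Rn n x * A 1 i) * \<theta> i)"
      using n by (simp add: mat_apply_def sum_distrib_left mult.assoc)
    also have "\<dots> = (\<Sum>i=1..n. x i * \<theta> i)"
      using A(2) by (intro sum.cong) auto
    finally show "norm_Rn n x * mat_apply n A \<theta> 1 = (\<Sum>i=1..n. x i * \<theta> i)" .
  qed
  finally show ?thesis ..
qed

lemma distr_gauss_inner:
  fixes n :: nat
  assumes \<theta>: "(\<Sum>i=1..n. (\<theta> i)\<^sup>2) = 1"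
  shows "distr (PiM {1..n} (\<lambda>_. pgauss 2)) borel (\<lambda>z. \<Sum>i=1..n. z i * \<theta> i) = pgauss 2"
proof -
  let ?G = "PiM {1..n} (\<lambda>_. pgauss 2)"
  interpret prob_space ?G by (rule prob_space_PiM_pgauss) simp
  \<comment> \<open>A zero coefficient would contribute a normal law of variance 0, which has no
    density. Such terms are dropped; as \<theta> is a unit vector, some index remains.\<close>
  define I where "I = {i\<in>{1..n}. \<theta> i \<noteq> 0}"
  have "I \<subseteq> {1..n}" unfolding I_def by blast
  then have I: "finite I" "I \<subseteq> {1..n}" using finite_subset[of I "{1..n}"] by auto
  have sumI: "(\<Sum>i=1..n. f i) = (\<Sum>i\<in>I. f i)" if "\<And>i. \<theta> i = 0 \<Longrightarrow> f i = 0" for f :: "nat \<Rightarrow> real"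
    using that by (intro sum.mono_neutral_right) (auto simp: I_def)
  have ne: "I \<noteq> {}"
    using \<theta> sumI[of "\<lambda>i. (\<theta> i)\<^sup>2"] by auto
  have comp: "distr ?G borel (\<lambda>z. z i) = pgauss 2" if "i \<in> {1..n}" for i
  proof -
    have "distr ?G borel (\<lambda>z. z i) = distr ?G (pgauss 2) (\<lambda>z. z i)"
      by (intro distr_cong) auto
    also have "\<dots> = pgauss 2"
      using that by (intro distr_PiM_component prob_space_pgauss) auto
    finally show ?thesis .
  qed
  \<comment> \<open>Under the product measure the tuple of all coordinates is the identity map, so
    its law is the product of the marginals, which characterises independence.\<close>
  have "indep_vars (\<lambda>_. borel) (\<lambda>i z. z i) {1..n}"
  proof (subst indep_vars_iff_distr_eq_PiM')
    show "{1..n} \<noteq> {}" using ne I by auto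
    show "random_variable borel (\<lambda>z. z i)" if "i \<in> {1..n}" for i
      using that by measurable
    have "distr ?G (PiM {1..n} (\<lambda>_. borel)) (\<lambda>x. \<lambda>i\<in>{1..n}. x i) = distr ?G ?G (\<lambda>x. x)"
      by (intro distr_cong sets_PiM_pgauss[symmetric]) (auto simp: space_PiM)
    also have "\<dots> = ?G" by (rule distr_id)
    also have "?G = (\<Pi>\<^sub>M i\<in>{1..n}. distr ?G borel (\<lambda>z. z i))"
      by (intro PiM_cong refl) (simp only: comp)
    finally show "distr ?G (PiM {1..n} (\<lambda>_. borel)) (\<lambda>x. \<lambda>i\<in>{1..n}. x i) = (\<Pi>\<^sub>M i\<in>{1..n}. distr ?G borel (\<lambda>z. z i))" .
  qed
  then have "indep_vars (\<lambda>_. borel) (\<lambda>i z. (\<lambda>t. t * \<theta> i) (z i)) {1..n}"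
    by (rule indep_vars_compose2) measurable
  then have ind: "indep_vars (\<lambda>_. borel) (\<lambda>i z. z i * \<theta> i) I"
    by (rule indep_vars_subset[OF _ I(2)])
  have "distributed ?G lborel (\<lambda>z. z i * \<theta> i) (normal_density 0 \<bar>\<theta> i\<bar>)" if "i \<in> I" for i
  proof -
    have "distributed ?G lborel (\<lambda>z. z i) std_normal_density"
      unfolding distributed_def
    proof (intro conjI)
      have "distr ?G lborel (\<lambda>z. z i) = distr ?G borel (\<lambda>z. z i)"
        by (intro distr_cong) auto
      then show "distr ?G lborel (\<lambda>z. z i) = density lborel std_normal_density"
        using comp[of i] that I pgauss_2 by auto
      have "i \<in> {1..n}" using that I by auto
      then show "random_variable lborel (\<lambda>z. z i)" by simp
    qed simp
    then have "distributed ?G lborel (\<lambda>z. 0 + \<theta> i * z i) (normal_density (0 + \<theta> i * 0) (\<bar>\<theta> i\<bar> * 1))"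
      using that by (intro normal_density_affine) (auto simp: I_def)
    then show ?thesis by (simp add: mult.commute)
  qed
  then have "distributed ?G lborel (\<lambda>z. \<Sum>i\<in>I. z i * \<theta> i) (normal_density (\<Sum>i\<in>I. 0) (sqrt (\<Sum>i\<in>I. \<bar>\<theta> i\<bar>\<^sup>2)))"
    by (intro sum_indep_normal I ne ind) (auto simp: I_def)
  moreover have "(\<Sum>i\<in>I. \<bar>\<theta> i\<bar>\<^sup>2) = 1"
    using \<theta> sumI[of "\<lambda>i. (\<theta> i)\<^sup>2"] by simp
  moreover have "(\<lambda>z. \<Sum>i\<in>I. z i * \<theta> i) = (\<lambda>z. \<Sum>i=1..n. z i * \<theta> i)"
    by (intro ext sumI[symmetric]) auto
  ultimately have "distr ?G lborel (\<lambda>z. \<Sum>i=1..n. z i * \<theta> i) = pgauss 2"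
    using pgauss_2 by (simp add: distributed_def)
  moreover have "distr ?G lborel (\<lambda>z. \<Sum>i=1..n. z i * \<theta> i) = distr ?G borel (\<lambda>z. \<Sum>i=1..n. z i * \<theta> i)"
    by (intro distr_cong) auto
  ultimately show ?thesis by simp
qed

text \<open>The inner product of a Gaussian vector z with an independent point \<theta> of the
  sphere is computed in two ways. Given \<theta> it is standard normal; given z it has the law of
  \<bar>z\<bar> \<theta>_1. Fubini equates the two, and u = \<bar>z\<bar>^2 is chi-squared with n
  degrees of freedom, a Gamma law of shape n/2 and scale 2, whence k = 0.\<close>

lemma radial_mixture_sphere:
  assumes \<sigma>: "rotation_invariant_sphere_prob n \<sigma>" and n: "n \<ge> 1"
  shows "radial_mixture n 2 (distr \<sigma> borel (\<lambda>\<theta>. \<theta> 1)) (pgauss 2)"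
proof -
  let ?G = "PiM {1..n} (\<lambda>_. pgauss 2)"
  interpret G: prob_space ?G by (rule prob_space_PiM_pgauss) simp
  interpret g: prob_space "pgauss 2" by (rule prob_space_pgauss) simp
  interpret PG: product_sigma_finite "\<lambda>_::nat. pgauss 2" by standard
  have sets [measurable_cong]: "sets \<sigma> = sets (borel_Rn n)" and "prob_space \<sigma>"
    and sph: "emeasure \<sigma> (unit_sphere n) = 1"
    using \<sigma> by (auto simp: rotation_invariant_sphere_prob_def)
  interpret s: prob_space \<sigma> by fact
  interpret P: pair_sigma_finite ?G \<sigma> by standard
  have [measurable]: "(\<lambda>\<theta>. \<theta> 1) \<in> borel_measurable \<sigma>"
    using n measurable_component_singleton[of 1 "{1..n}" "\<lambda>_. borel :: real measure"]
    by (simp add: measurable_cong_sets[OF sets refl] del: One_nat_def)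
  have [measurable]: "unit_sphere n \<in> sets (borel_Rn n)"
  proof -
    have "(\<lambda>x. \<Sum>i=1..n. (x i)\<^sup>2) \<in> borel_measurable (borel_Rn n)" by measurable
    from measurable_sets[OF this, of "{1}"] show ?thesis
      by (simp add: unit_sphere_def vimage_def Int_def conj_commute del: One_nat_def)
  qed
  have "AE \<theta> in \<sigma>. \<theta> \<in> unit_sphere n"
    using sph by (subst s.AE_in_set_eq_1) (auto simp: s.emeasure_eq_measure)
  then have unit: "AE \<theta> in \<sigma>. (\<Sum>i=1..n. (\<theta> i)\<^sup>2) = 1"
    by eventually_elim (auto simp: unit_sphere_def)
  have "(\<lambda>z. \<Sum>i=1..n. (z i)\<^sup>2) \<in> borel_measurable (borel_Rn n)"
    by measurable
  then have [measurable]: "(\<lambda>z. \<Sum>i=1..n. (z i)\<^sup>2) \<in> borel_measurable ?G"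
    by (simp only: measurable_cong_sets[OF sets_PiM_pgauss refl])
  define \<nu> where "\<nu> = distr ?G borel (\<lambda>z. \<Sum>i=1..n. (z i)\<^sup>2)"
  have nu: "prob_space \<nu>" unfolding \<nu>_def by (intro G.prob_space_distr) measurable
  have mgf: "(\<integral>\<^sup>+u. ennreal (exp (l * u)) \<partial>\<nu>) = ennreal ((1 - l * 2) powr (- (n / 2 + 0)))"
    if l: "l * 2 < 1" for l
  proof -
    have "(\<integral>\<^sup>+u. ennreal (exp (l * u)) \<partial>\<nu>) = (\<integral>\<^sup>+z. (\<Prod>i\<in>{1..n}. ennreal (exp (l * (z i)\<^sup>2))) \<partial>?G)"
      unfolding \<nu>_def by (subst nn_integral_distr) (auto simp: sum_distrib_left exp_sum prod_ennreal simp del: One_nat_def)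
    also have "\<dots> = (\<Prod>i\<in>{1..n}. \<integral>\<^sup>+t. ennreal (exp (l * t\<^sup>2)) \<partial>pgauss 2)"
    proof (rule PG.product_nn_integral_prod)
      have "(\<lambda>t. ennreal (exp (l * t\<^sup>2))) \<in> borel_measurable borel" by measurable
      then show "(\<lambda>t. ennreal (exp (l * t\<^sup>2))) \<in> borel_measurable (pgauss 2)"
        by (simp only: measurable_cong_sets[OF sets_pgauss refl])
    qed simp
    also have "(\<integral>\<^sup>+t. ennreal (exp (l * t\<^sup>2)) \<partial>pgauss 2) = ennreal ((1 - l * 2) powr (- (1 / 2)))"
      using pgauss_mgf[of 2 l] l by simp
    finally show ?thesis
      using l by (simp add: ennreal_power powr_realpow[symmetric] powr_powr)
  qed
  have pos: "AE u in \<nu>. 0 \<le> u"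
    unfolding \<nu>_def by (subst AE_distr_iff) (auto intro!: AE_I2 sum_nonneg simp del: One_nat_def)
  have mix: "(\<integral>\<^sup>+t. f t \<partial>pgauss 2)
      = (\<integral>\<^sup>+u. (\<integral>\<^sup>+s. f (u powr (1 / 2) * s) \<partial>distr \<sigma> borel (\<lambda>\<theta>. \<theta> 1)) \<partial>\<nu>)"
    if [measurable]: "f \<in> borel_measurable borel" for f
  proof -
    have "(\<integral>\<^sup>+t. f t \<partial>pgauss 2) = (\<integral>\<^sup>+\<theta>. (\<integral>\<^sup>+t. f t \<partial>pgauss 2) \<partial>\<sigma>)"
      by (simp add: s.emeasure_space_1)
    also have "\<dots> = (\<integral>\<^sup>+\<theta>. (\<integral>\<^sup>+z. f (\<Sum>i=1..n. z i * \<theta> i) \<partial>?G) \<partial>\<sigma>)"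
    proof (rule nn_integral_cong_AE, use unit in eventually_elim)
      case (elim \<theta>)
      have "(\<integral>\<^sup>+t. f t \<partial>pgauss 2) = (\<integral>\<^sup>+t. f t \<partial>distr ?G borel (\<lambda>z. \<Sum>i=1..n. z i * \<theta> i))"
        by (simp only: distr_gauss_inner[OF elim])
      also have "\<dots> = (\<integral>\<^sup>+z. f (\<Sum>i=1..n. z i * \<theta> i) \<partial>?G)"
      proof (rule nn_integral_distr)
        have "(\<lambda>z. \<Sum>i=1..n. z i * \<theta> i) \<in> borel_measurable (borel_Rn n)" by measurable
        then show "(\<lambda>z. \<Sum>i=1..n. z i * \<theta> i) \<in> borel_measurable ?G"
          by (simp only: measurable_cong_sets[OF sets_PiM_pgauss refl])
      qed (simp only: measurable_distr_eq1 that)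
      finally show ?case .
    qed
    also have "\<dots> = (\<integral>\<^sup>+z. (\<integral>\<^sup>+\<theta>. f (\<Sum>i=1..n. z i * \<theta> i) \<partial>\<sigma>) \<partial>?G)"
      by (rule P.Fubini') measurable
    also have "\<dots> = (\<integral>\<^sup>+z. (\<integral>\<^sup>+\<theta>. f (norm_Rn n z * \<theta> 1) \<partial>\<sigma>) \<partial>?G)"
      by (simp only: nn_integral_sphere_inner[OF \<sigma> n that])
    also have "\<dots> = (\<integral>\<^sup>+z. (\<integral>\<^sup>+\<theta>. f ((\<Sum>i=1..n. (z i)\<^sup>2) powr (1 / 2) * \<theta> 1) \<partial>\<sigma>) \<partial>?G)"
      by (simp add: norm_Rn_def powr_half_sqrt sum_nonneg)
    also have "\<dots> = (\<integral>\<^sup>+u. (\<integral>\<^sup>+\<theta>. f (u powr (1 / 2) * \<theta> 1) \<partial>\<sigma>) \<partial>\<nu>)"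
    proof -
      have [measurable]: "(\<lambda>u. \<integral>\<^sup>+\<theta>. f (u powr (1 / 2) * \<theta> 1) \<partial>\<sigma>) \<in> borel_measurable borel"
        by measurable
      show ?thesis
        unfolding \<nu>_def by (rule nn_integral_distr[symmetric]) measurable
    qed
    finally show ?thesis
      by (simp add: nn_integral_distr del: One_nat_def)
  qed
  have "prob_space (distr \<sigma> borel (\<lambda>\<theta>. \<theta> 1))" "sets \<nu> = sets borel"
    by (intro s.prob_space_distr; measurable) (simp add: \<nu>_def)
  then show ?thesis
    unfolding radial_mixture_def
    using nu mgf pos mix
    by (auto intro!: exI[of _ \<nu>] exI[of _ 0] g.prob_space_axioms simp del: One_nat_def)
qed

text \<open>One factor 1 - e keeps the tilt of T subcritical, the other pays for the dilation. The
  factor 2 appears because the retained event eventually has probability at least 1/2.\<close>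

lemma radial_mixture_exp_moment_eventually:
  fixes q e C b :: real
  assumes mix: "\<And>n. n \<ge> 1 \<Longrightarrow> radial_mixture n q (S n) (T n)" and q: "q \<ge> 1" and e: "0 < e" "e \<le> 1"
    and bound: "\<And>n::nat. n \<ge> 1 \<Longrightarrow>
        (\<integral>\<^sup>+t. ennreal (exp ((1 - e) / q * \<bar>t\<bar> powr q)) \<partial>T n) \<le> ennreal (exp (C * n powr b))"
  shows "\<forall>\<^sub>F n in sequentially.
     (\<integral>\<^sup>+s. ennreal (exp ((1 - e)\<^sup>2 * n * (\<bar>s\<bar> powr q / q))) \<partial>S n) \<le> ennreal (2 * exp (C * n powr b))"
proof -
  have "(\<lambda>n. exp (- (e\<^sup>2 / (4 * q)) * real n)) \<longlonglongrightarrow> 0"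
    using e q by real_asymp
  then have "\<forall>\<^sub>F n in sequentially. exp (- (e\<^sup>2 / (4 * q)) * real n) < 1/2"
    by (rule order_tendstoD) simp
  then show ?thesis
    using eventually_ge_at_top[of 1]
  proof eventually_elim
    case (elim n)
    let ?I = "\<integral>\<^sup>+s. ennreal (exp ((1 - e)\<^sup>2 * n * (\<bar>s\<bar> powr q / q))) \<partial>S n"
    have "?I * ennreal (1/2) \<le> ?I * ennreal (1 - exp (- (e\<^sup>2 / (4 * q)) * n))"
      using elim by (intro mult_left_mono ennreal_leI) auto
    also have "\<dots> \<le> (\<integral>\<^sup>+t. ennreal (exp ((1 - e) / q * \<bar>t\<bar> powr q)) \<partial>T n)"
      using radial_mixture_exp_moment[OF mix[OF elim(2)] q e, of "(1 - e) / q"] e q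
      by (simp add: power2_eq_square mult_ac)
    also have "\<dots> \<le> ennreal (exp (C * n powr b))"
      by (rule bound[OF elim(2)])
    finally have "ennreal 2 * (?I * ennreal (1/2)) \<le> ennreal 2 * ennreal (exp (C * n powr b))"
      by (intro mult_left_mono) auto
    moreover have "ennreal 2 * (?I * ennreal (1/2)) = ?I"
    proof -
      have "ennreal 2 * ennreal (1/2) = 1"
        by (subst ennreal_mult'[symmetric]) auto
      then show ?thesis by (simp only: mult.left_commute[of "ennreal 2"] mult_1_right)
    qed
    ultimately show "?I \<le> ennreal (2 * exp (C * n powr b))"
      by (simp add: ennreal_mult')
  qed
qed

text \<open>A dilation of size about n^(1/q) lifts the threshold of S to order n^(r/q), where the
  tail of T is known to be at least of order exp (- O(n^r)). The error from atypical dilations is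
  exp (- O(n)); as r < 1, it can be subtracted.\<close>

lemma radial_mixture_tail_eventually:
  assumes mix: "\<And>n. n \<ge> 1 \<Longrightarrow> radial_mixture n q (S n) (T n)" and q: "q \<ge> 1"
    and c: "c > 0" and r: "0 < r" "r < 1" and s: "s > 0" and h: "h > 0"
    and tail: "\<And>(n::nat) x. n \<ge> 1 \<Longrightarrow> x \<ge> 0 \<Longrightarrow> ennreal (exp (- ((x + 1) powr q / q)) / c) \<le> emeasure (T n) {x..}"
  shows "\<forall>\<^sub>F n in sequentially.
     ennreal (exp (- (n powr r * (s powr q / q + h)))) \<le> emeasure (S n) {s * n powr ((r - 1) / q)..}"
proof -
  define a where "a = s powr q / q"
  have a: "a > 0" using s q by (simp add: a_def)
  \<comment> \<open>Chosen so that enlarging the threshold by the dilation factor 1 + e raises the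
    rate a by at most h / 4.\<close>
  define e where "e = min 1 (h / (4 * a))"
  have e: "0 < e" "e \<le> 1" using h a by (auto simp: e_def)
  have ae: "(1 + e) * a \<le> a + h / 4"
  proof -
    have "e * a \<le> h / (4 * a) * a" using a by (intro mult_right_mono) (auto simp: e_def)
    then show ?thesis using a by (simp add: algebra_simps)
  qed
  define w where "w = s * (1 + e) powr (1 / q)"
  have w: "w > 0" "w powr q / q = (1 + e) * a"
    using s e q by (auto simp: w_def a_def powr_mult powr_powr)
  define d where "d = e\<^sup>2 / (8 * q)"
  have d: "d > 0" using e q by (simp add: d_def)
  have lim: "(\<lambda>n. (1 + 1 / w * real n powr (- (r / q))) powr q) \<longlonglongrightarrow> 1"
  proof -
    have "(\<lambda>n. real n powr (- (r / q))) \<longlonglongrightarrow> 0"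
      using r q by (intro tendsto_neg_powr filterlim_real_sequentially) auto
    then have "(\<lambda>n. (1 + 1 / w * real n powr (- (r / q))) powr q) \<longlonglongrightarrow> (1 + 1 / w * 0) powr q"
      by (intro tendsto_powr tendsto_add tendsto_mult tendsto_const) auto
    then show ?thesis by simp
  qed
  \<comment> \<open>The tail of T is evaluated at w n^(r/q) + 1. The ratio k is the room for the
    relative error of this shift, which turns a + h / 4 into a + h / 2.\<close>
  define k where "k = (a + h / 2) / (a + h / 4)"
  have k: "k > 1" using a h by (simp add: k_def)
  have "\<forall>\<^sub>F n in sequentially. (1 + 1 / w * real n powr (- (r / q))) powr q < k"
    using order_tendstoD(2)[OF lim k] .
  \<comment> \<open>Two copies of the target are needed, one to keep and one to cancel the dilation
    error; the remaining slack h / 2 absorbs the factor 2 c.\<close>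
  moreover have "\<forall>\<^sub>F n in sequentially. 2 * exp (- (real n powr r * (a + h))) \<le> exp (- (real n powr r * (a + h / 2))) / c"
  proof -
    have "\<forall>\<^sub>F n in sequentially. 2 * c \<le> exp (real n powr r * (h / 2))"
      using r h by real_asymp
    then show ?thesis
    proof eventually_elim
      case (elim n)
      have "2 * c * exp (- (real n powr r * (a + h))) \<le> exp (real n powr r * (h / 2)) * exp (- (real n powr r * (a + h)))"
        using elim by (intro mult_right_mono) auto
      also have "\<dots> = exp (- (real n powr r * (a + h / 2)))"
        unfolding exp_add[symmetric] by (simp add: algebra_simps)
      finally show ?case using c by (simp add: field_simps)
    qed
  qed
  moreover have "\<forall>\<^sub>F n in sequentially. exp (1 - d * real n) \<le> exp (- (real n powr r * (a + h)))"
    using r d a h by real_asymp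
  ultimately show ?thesis
    using eventually_ge_at_top[of 1]
  proof eventually_elim
    case (elim n)
    let ?x = "s * n powr ((r - 1) / q)"
    have x: "?x > 0" using s elim by simp
    have X: "?x * (n * (1 + e)) powr (1 / q) = w * n powr (r / q)"
    proof -
      have "n powr ((r - 1) / q) * n powr (1 / q) = n powr (r / q)"
        using q by (simp add: powr_add[symmetric] add_divide_distrib[symmetric])
      then show ?thesis
        using e by (simp add: powr_mult w_def mult_ac)
    qed
    have "(w * n powr (r / q) + 1) powr q / q \<le> n powr r * (a + h / 2)"
    proof -
      have "w * n powr (r / q) + 1 = w * n powr (r / q) * (1 + 1 / w * n powr (- (r / q)))"
        using w elim(4) by (simp add: field_simps powr_minus)
      then have "(w * n powr (r / q) + 1) powr q = (w * n powr (r / q)) powr q * (1 + 1 / w * n powr (- (r / q))) powr q"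
        by (simp only: powr_mult)
      moreover have "(w * n powr (r / q)) powr q = w powr q * n powr r"
        using q by (simp add: powr_mult powr_powr)
      ultimately have "(w * n powr (r / q) + 1) powr q / q
          = (w powr q / q) * (n powr r) * (1 + 1 / w * n powr (- (r / q))) powr q"
        by simp
      also have "\<dots> \<le> (a + h / 4) * n powr r * k"
        using ae w a e h elim(1) k by (intro mult_mono) auto
      also have "\<dots> = n powr r * (a + h / 2)"
        using a h by (simp add: k_def)
      finally show ?thesis .
    qed
    then have "2 * exp (- (n powr r * (a + h))) \<le> exp (- ((w * n powr (r / q) + 1) powr q / q)) / c"
      using c by (intro order_trans[OF elim(2)] divide_right_mono) auto
    then have "ennreal (2 * exp (- (n powr r * (a + h)))) \<le> emeasure (T n) {w * n powr (r / q)..}"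
      using tail[OF elim(4), of "w * n powr (r / q)"] w by (meson ennreal_leI less_imp_le mult_nonneg_nonneg order_trans powr_ge_zero)
    also have "\<dots> \<le> emeasure (S n) {?x..} + ennreal (exp (1 - e\<^sup>2 / (8 * q) * n))"
      unfolding X[symmetric] using elim(4) by (intro radial_mixture_tail[OF mix q e x]) auto
    also have "\<dots> \<le> emeasure (S n) {?x..} + ennreal (exp (- (n powr r * (a + h))))"
      using elim(3) by (intro add_left_mono ennreal_leI) (simp add: d_def)
    finally have "ennreal (exp (- (n powr r * (a + h)))) + ennreal (exp (- (n powr r * (a + h))))
        \<le> emeasure (S n) {?x..} + ennreal (exp (- (n powr r * (a + h))))"
      by (simp flip: ennreal_plus)
    then show ?case
      unfolding a_def by (simp add: ennreal_add_left_cancel_le add.commute)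
  qed
qed

section \<open>Deviations of the product\<close>

lemma r_exp_props:
  assumes "1 \<le> p" "p < 2"
  shows "0 < r_exp p" "r_exp p < 1" "p / 2 < r_exp p" "r_exp p * (1 / p + 1 / 2) = 1"
proof -
  have "p * 4 + p * (p * 2) > 0" using assms by (intro add_pos_pos) auto
  then show "0 < r_exp p" "r_exp p < 1" "p / 2 < r_exp p" "r_exp p * (1 / p + 1 / 2) = 1"
    using assms by (auto simp: r_exp_def field_simps)
qed

lemma young_r_exp:
  assumes p: "1 \<le> p" "p < 2" and "s \<ge> 0" "z \<ge> 0"
  shows "(s * z) powr r_exp p / r_exp p \<le> s powr p / p + z\<^sup>2 / 2"
proof -
  let ?r = "r_exp p"
  note r = r_exp_props[OF p]
  have conj: "1 / (p / ?r) + 1 / (2 / ?r) = 1"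
    using r(4) p by (simp add: field_simps)
  have "s powr ?r * z powr ?r \<le> (s powr ?r) powr (p / ?r) / (p / ?r) + (z powr ?r) powr (2 / ?r) / (2 / ?r)"
    using r p conj by (intro Youngs_inequality) auto
  also have "\<dots> = ?r * (s powr p / p + z\<^sup>2 / 2)"
    using r(1) assms(4) by (cases "z = 0") (simp_all add: powr_powr algebra_simps)
  finally show ?thesis
    using r(1) assms by (simp add: powr_mult field_simps)
qed

definition W_scale :: "nat \<Rightarrow> real \<Rightarrow> real" where
  "W_scale n p = real n powr (1 / p) / real n powr (1 / 2)"

lemma W_scale_eq: "n \<ge> 1 \<Longrightarrow> W_scale n p = real n powr (1 / p - 1 / 2)"
  by (simp add: W_scale_def powr_diff)

text \<open>This homogeneity converts the speed n^r of the product into the speed n at which each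
  factor is tilted.\<close>

lemma W_scale_powr:
  assumes p: "1 \<le> p" "p < 2" and n: "n \<ge> 1"
  shows "real n powr r_exp p * W_scale n p powr r_exp p = n"
proof -
  have "real n powr r_exp p * W_scale n p powr r_exp p = n powr (r_exp p + (1 / p - 1 / 2) * r_exp p)"
    by (simp add: W_scale_eq[OF n] powr_powr powr_add)
  also have "r_exp p + (1 / p - 1 / 2) * r_exp p = r_exp p * (1 / p + 1 / 2)"
    by (simp add: algebra_simps)
  finally show ?thesis using n r_exp_props(4)[OF p] by simp
qed

text \<open>Markov's inequality is applied to exp (a n^r \<bar>w\<bar>^r / r). Young's inequality is
  used inside the integral, where the exponential of a sum factorises.\<close>

lemma product_tail_upper:
  fixes S Z P :: "nat \<Rightarrow> real measure"
  assumes p: "1 \<le> p" "p < 2"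
    and sets: "\<And>n. n \<ge> 1 \<Longrightarrow> sets (S n) = sets borel" "\<And>n. n \<ge> 1 \<Longrightarrow> sets (Z n) = sets borel"
      "\<And>n. n \<ge> 1 \<Longrightarrow> sets (P n) = sets borel"
    and P: "\<And>n f. n \<ge> 1 \<Longrightarrow> f \<in> borel_measurable borel \<Longrightarrow>
      (\<integral>\<^sup>+w. f w \<partial>P n) = (\<integral>\<^sup>+s. (\<integral>\<^sup>+z. f (W_scale n p * (s * z)) \<partial>Z n) \<partial>S n)"
    and S: "\<And>e::real. 0 < e \<Longrightarrow> e \<le> 1 \<Longrightarrow> \<exists>C. \<forall>\<^sub>F n in sequentially.
      (\<integral>\<^sup>+s. ennreal (exp ((1 - e)\<^sup>2 * n * (\<bar>s\<bar> powr p / p))) \<partial>S n) \<le> ennreal (2 * exp (C * n powr (p / 2)))"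
    and Z: "\<And>e::real. 0 < e \<Longrightarrow> e \<le> 1 \<Longrightarrow> \<exists>C. \<forall>\<^sub>F n in sequentially.
      (\<integral>\<^sup>+z. ennreal (exp ((1 - e)\<^sup>2 * n * (\<bar>z\<bar> powr 2 / 2))) \<partial>Z n) \<le> ennreal (2 * exp C)"
    and t: "t > 0" and h: "h > 0"
  shows "\<forall>\<^sub>F n in sequentially. emeasure (P n) {w. t \<le> \<bar>w\<bar>}
      \<le> ennreal (exp (- (n powr r_exp p * (t powr r_exp p / r_exp p - h))))"
proof -
  define r where "r = r_exp p"
  note r = r_exp_props[OF p, folded r_def]
  define A where "A = t powr r / r"
  have A: "A > 0" using t r by (simp add: A_def)
  \<comment> \<open>As (1 - e)^2 >= 1 - 2 e, the tilt a loses at most h / 2 of the rate A; the other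
    h / 2 is spent on the moment bounds.\<close>
  define e where "e = min 1 (h / (4 * A))"
  have e: "0 < e" "e \<le> 1" using A h by (auto simp: e_def)
  define a where "a = (1 - e)\<^sup>2"
  have a: "a \<ge> 0" by (simp add: a_def)
  have aA: "a * A \<ge> A - h / 2"
  proof -
    have "e * A \<le> h / (4 * A) * A" using A by (intro mult_right_mono) (auto simp: e_def)
    then have "2 * e * A \<le> h / 2" using A by simp
    moreover have "a \<ge> 1 - 2 * e" by (simp add: a_def power2_eq_square algebra_simps)
    then have "a * A \<ge> (1 - 2 * e) * A" using A by (intro mult_right_mono) auto
    ultimately show ?thesis by (simp add: algebra_simps)
  qed
  obtain C1 where C1: "\<forall>\<^sub>F n in sequentially.
      (\<integral>\<^sup>+s. ennreal (exp (a * n * (\<bar>s\<bar> powr p / p))) \<partial>S n) \<le> ennreal (2 * exp (C1 * n powr (p / 2)))"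
    using S[OF e] unfolding a_def by blast
  obtain C2 where C2: "\<forall>\<^sub>F n in sequentially.
      (\<integral>\<^sup>+z. ennreal (exp (a * n * (\<bar>z\<bar> powr 2 / 2))) \<partial>Z n) \<le> ennreal (2 * exp C2)"
    using Z[OF e] unfolding a_def by blast
  have "\<forall>\<^sub>F n in sequentially. 2 * exp (\<bar>C1\<bar> * real n powr (p / 2)) * (2 * exp C2) \<le> exp (n powr r * (h / 2))"
  proof -
    have "((\<lambda>n. real n powr (p / 2 - r)) \<longlongrightarrow> 0) sequentially"
      using r by (intro tendsto_neg_powr filterlim_real_sequentially) auto
    then have "((\<lambda>n. (\<bar>C1\<bar> + \<bar>C2\<bar> + 2) * real n powr (p / 2 - r)) \<longlongrightarrow> 0) sequentially"
      by (rule tendsto_mult_right_zero)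
    then have "\<forall>\<^sub>F n in sequentially. (\<bar>C1\<bar> + \<bar>C2\<bar> + 2) * real n powr (p / 2 - r) < h / 2"
      using h by (intro order_tendstoD(2)[where y=0]) simp_all
    then show ?thesis
      using eventually_ge_at_top[of 1]
    proof eventually_elim
      case (elim n)
      let ?m = "real n powr (p / 2)"
      have m: "?m \<ge> 1" using elim p by (intro ge_one_powr_ge_zero) auto
      have "2 \<le> exp (1::real)" using exp_ge_add_one_self[of 1] by simp
      then have "(2 * exp (\<bar>C1\<bar> * ?m)) * (2 * exp C2) \<le> (exp 1 * exp (\<bar>C1\<bar> * ?m)) * (exp 1 * exp C2)"
        by (intro mult_mono) auto
      also have "\<dots> = exp (\<bar>C1\<bar> * ?m + (C2 + 2))"
        by (simp add: exp_add[symmetric])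
      also have "\<dots> \<le> exp ((\<bar>C1\<bar> + \<bar>C2\<bar> + 2) * ?m)"
      proof -
        have "(\<bar>C2\<bar> + 2) * 1 \<le> (\<bar>C2\<bar> + 2) * ?m" using m by (intro mult_left_mono) auto
        then show ?thesis by (simp add: algebra_simps)
      qed
      also have "\<dots> \<le> exp (n powr r * (h / 2))"
      proof -
        have "(\<bar>C1\<bar> + \<bar>C2\<bar> + 2) * ?m = n powr r * ((\<bar>C1\<bar> + \<bar>C2\<bar> + 2) * real n powr (p / 2 - r))"
          using elim by (simp add: powr_diff)
        also have "\<dots> \<le> n powr r * (h / 2)"
          using elim by (intro mult_left_mono) auto
        finally show ?thesis by simp
      qed
      finally show ?case .
    qed
  qed
  then show ?thesis
    using C1 C2 eventually_ge_at_top[of 1]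
  proof eventually_elim
    case (elim n)
    note [measurable_cong] = sets[OF elim(4)]
    let ?k = "W_scale n p"
    have k: "?k \<ge> 0" by (simp add: W_scale_def)
    have [simp]: "space (P n) = UNIV" using sets_eq_imp_space_eq[OF sets(3)[OF elim(4)]] by simp
    let ?t = "ennreal (exp (- (a * n powr r * A)))"
    have "emeasure (P n) {w. t \<le> \<bar>w\<bar>} = (\<integral>\<^sup>+w. indicator {w. t \<le> \<bar>w\<bar>} w \<partial>P n)"
      by (subst nn_integral_indicator) auto
    also have "\<dots> \<le> (\<integral>\<^sup>+w. ?t * ennreal (exp (a * n powr r * (\<bar>w\<bar> powr r / r))) \<partial>P n)"
    proof (intro nn_integral_mono)
      fix w :: real
      show "indicator {w. t \<le> \<bar>w\<bar>} w \<le> ?t * ennreal (exp (a * n powr r * (\<bar>w\<bar> powr r / r)))"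
      proof (cases "t \<le> \<bar>w\<bar>")
        case True
        then have "A \<le> \<bar>w\<bar> powr r / r"
          unfolding A_def using t r by (intro divide_right_mono powr_mono2) auto
        then have "a * n powr r * A \<le> a * n powr r * (\<bar>w\<bar> powr r / r)"
          using a by (intro mult_left_mono) auto
        then have "ennreal 1 \<le> ennreal (exp (- (a * n powr r * A) + a * n powr r * (\<bar>w\<bar> powr r / r)))"
          by (intro ennreal_leI) simp
        also have "\<dots> = ?t * ennreal (exp (a * n powr r * (\<bar>w\<bar> powr r / r)))"
          unfolding exp_add by (rule ennreal_mult') simp
        finally show ?thesis using True by simp
      qed simp
    qed
    also have "\<dots> = ?t * (\<integral>\<^sup>+w. ennreal (exp (a * n powr r * (\<bar>w\<bar> powr r / r))) \<partial>P n)"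
      by (rule nn_integral_cmult) measurable
    also have "(\<integral>\<^sup>+w. ennreal (exp (a * n powr r * (\<bar>w\<bar> powr r / r))) \<partial>P n)
        = (\<integral>\<^sup>+s. (\<integral>\<^sup>+z. ennreal (exp (a * n powr r * (\<bar>?k * (s * z)\<bar> powr r / r))) \<partial>Z n) \<partial>S n)"
      by (rule P[OF elim(4)]) measurable
    also have "\<dots> \<le> (\<integral>\<^sup>+s. (\<integral>\<^sup>+z. ennreal (exp (a * n * (\<bar>s\<bar> powr p / p))) * ennreal (exp (a * n * (\<bar>z\<bar> powr 2 / 2))) \<partial>Z n) \<partial>S n)"
    proof (intro nn_integral_mono)
      fix s z :: real
      have "n powr r * (\<bar>?k * (s * z)\<bar> powr r / r) = (n powr r * ?k powr r) * ((\<bar>s\<bar> * \<bar>z\<bar>) powr r / r)"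
        using k by (simp add: abs_mult powr_mult)
      also have "\<dots> = n * ((\<bar>s\<bar> * \<bar>z\<bar>) powr r / r)"
        using W_scale_powr[OF p elim(4)] by (simp add: r_def)
      also have "\<dots> \<le> n * (\<bar>s\<bar> powr p / p + \<bar>z\<bar>\<^sup>2 / 2)"
        unfolding r_def by (intro mult_left_mono young_r_exp p) auto
      finally have "a * (n powr r * (\<bar>?k * (s * z)\<bar> powr r / r)) \<le> a * (n * (\<bar>s\<bar> powr p / p + \<bar>z\<bar>\<^sup>2 / 2))"
        using a by (intro mult_left_mono)
      then have "a * n powr r * (\<bar>?k * (s * z)\<bar> powr r / r) \<le> a * n * (\<bar>s\<bar> powr p / p) + a * n * (\<bar>z\<bar> powr 2 / 2)"
        by (simp add: algebra_simps)
      then show "ennreal (exp (a * n powr r * (\<bar>?k * (s * z)\<bar> powr r / r)))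
          \<le> ennreal (exp (a * n * (\<bar>s\<bar> powr p / p))) * ennreal (exp (a * n * (\<bar>z\<bar> powr 2 / 2)))"
        by (subst ennreal_mult'[symmetric]) (auto simp: exp_add[symmetric] intro!: ennreal_leI)
    qed
    also have "\<dots> = (\<integral>\<^sup>+s. ennreal (exp (a * n * (\<bar>s\<bar> powr p / p))) \<partial>S n) * (\<integral>\<^sup>+z. ennreal (exp (a * n * (\<bar>z\<bar> powr 2 / 2))) \<partial>Z n)"
    proof -
      have "(\<lambda>z. ennreal (exp (a * n * (\<bar>z\<bar> powr 2 / 2)))) \<in> borel_measurable (Z n)"
        "(\<lambda>s. ennreal (exp (a * n * (\<bar>s\<bar> powr p / p)))) \<in> borel_measurable (S n)"
        using sets[OF elim(4)] by (simp_all cong: measurable_cong_sets)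
      then show ?thesis
        by (simp only: nn_integral_cmult nn_integral_multc)
    qed
    also have "\<dots> \<le> ennreal (2 * exp (C1 * n powr (p / 2))) * ennreal (2 * exp C2)"
      by (intro mult_mono elim) auto
    also have "\<dots> = ennreal (2 * exp (C1 * n powr (p / 2)) * (2 * exp C2))"
      by (rule ennreal_mult[symmetric]) auto
    also have "\<dots> \<le> ennreal (2 * exp (\<bar>C1\<bar> * n powr (p / 2)) * (2 * exp C2))"
      by (intro ennreal_leI mult_right_mono mult_left_mono) (auto intro!: mult_right_mono)
    also have "\<dots> \<le> ennreal (exp (n powr r * (h / 2)))"
      by (intro ennreal_leI elim)
    finally have "emeasure (P n) {w. t \<le> \<bar>w\<bar>} \<le> ?t * ennreal (exp (n powr r * (h / 2)))"
      by (simp add: mult_left_mono)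
    also have "\<dots> = ennreal (exp (n powr r * (h / 2 - a * A)))"
      by (simp add: ennreal_mult'[symmetric] exp_add[symmetric] algebra_simps)
    also have "\<dots> \<le> ennreal (exp (- (n powr r * (A - h))))"
    proof -
      have "n powr r * (h / 2 - a * A) \<le> n powr r * (- (A - h))"
        using aA by (intro mult_left_mono) auto
      then show ?thesis by (intro ennreal_leI) (simp only: exp_le_cancel_iff mult_minus_right)
    qed
    finally show ?case by (simp add: A_def r_def)
  qed
qed

lemma product_tail_lower:
  fixes S Z P :: "nat \<Rightarrow> real measure"
  assumes p: "1 \<le> p" "p < 2"
    and sets: "\<And>n. n \<ge> 1 \<Longrightarrow> sets (S n) = sets borel" "\<And>n. n \<ge> 1 \<Longrightarrow> sets (Z n) = sets borel"
      "\<And>n. n \<ge> 1 \<Longrightarrow> sets (P n) = sets borel"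
    and P: "\<And>n f. n \<ge> 1 \<Longrightarrow> f \<in> borel_measurable borel \<Longrightarrow>
      (\<integral>\<^sup>+w. f w \<partial>P n) = (\<integral>\<^sup>+s. (\<integral>\<^sup>+z. f (W_scale n p * (s * z)) \<partial>Z n) \<partial>S n)"
    and S: "\<And>y h. y > 0 \<Longrightarrow> h > 0 \<Longrightarrow> \<forall>\<^sub>F n in sequentially.
      ennreal (exp (- (n powr r_exp p * (y powr p / p + h)))) \<le> emeasure (S n) {y * n powr ((r_exp p - 1) / p)..}"
    and Z: "\<And>y h. y > 0 \<Longrightarrow> h > 0 \<Longrightarrow> \<forall>\<^sub>F n in sequentially.
      ennreal (exp (- (n powr r_exp p * (y powr 2 / 2 + h)))) \<le> emeasure (Z n) {y * n powr ((r_exp p - 1) / 2)..}"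
    and w: "w > 0" and h: "h > 0"
  shows "\<forall>\<^sub>F n in sequentially. ennreal (exp (- (n powr r_exp p * (w powr r_exp p / r_exp p + h))))
      \<le> emeasure (P n) {w..}"
proof -
  define r where "r = r_exp p"
  note r = r_exp_props[OF p, folded r_def]
  \<comment> \<open>The equality case of Young's inequality: y^p = z^2 = w^r, so both rates are
    proportional to w^r and their weights 1/p and 1/2 add up to 1/r.\<close>
  define y z where "y = w powr (r / p)" and "z = w powr (r / 2)"
  have yz: "y > 0" "z > 0" using w by (auto simp: y_def z_def)
  have prod: "y * z = w"
  proof -
    have "y * z = w powr (r * (1 / p + 1 / 2))"
      by (simp add: y_def z_def powr_add[symmetric] distrib_left)
    then show ?thesis using r(4) w by simp
  qed
  have rate: "y powr p / p + z powr 2 / 2 = w powr r / r"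
  proof -
    have "y powr p / p + z powr 2 / 2 = w powr r * (1 / p + 1 / 2)"
      using p by (simp add: y_def z_def powr_powr distrib_left del: powr_numeral)
    also have "1 / p + 1 / 2 = 1 / r"
      using r(1) r(4) by (simp add: eq_divide_eq mult.commute)
    finally show ?thesis by simp
  qed
  show ?thesis
    unfolding r_def[symmetric]
    using S[OF yz(1) half_gt_zero[OF h], folded r_def] Z[OF yz(2) half_gt_zero[OF h], folded r_def]
      eventually_ge_at_top[of 1]
  proof eventually_elim
    case (elim n)
    note sets' = sets[OF elim(3)]
    let ?k = "W_scale n p" and ?y = "y * n powr ((r - 1) / p)" and ?z = "z * n powr ((r - 1) / 2)"
    \<comment> \<open>The powers of n add up to r (1/p + 1/2) - 1 = 0.\<close>
    have k: "?k * (?y * ?z) = w"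
    proof -
      have "n powr (1 / p - 1 / 2) * (n powr ((r - 1) / p) * n powr ((r - 1) / 2))
          = n powr (r * (1 / p + 1 / 2) - 1)"
        unfolding powr_add[symmetric] by (simp add: algebra_simps diff_divide_distrib)
      also have "\<dots> = 1" using r(4) elim by simp
      finally show ?thesis
        using prod by (simp add: W_scale_eq[OF elim(3)] mult_ac)
    qed
    have "ennreal (exp (- (n powr r * (w powr r / r + h))))
        = ennreal (exp (- (n powr r * (y powr p / p + h / 2)))) * ennreal (exp (- (n powr r * (z powr 2 / 2 + h / 2))))"
      unfolding rate[symmetric] by (subst ennreal_mult'[symmetric]) (auto simp: exp_add[symmetric] algebra_simps)
    also have "\<dots> \<le> emeasure (S n) {?y..} * emeasure (Z n) {?z..}"
      by (intro mult_mono elim) auto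
    also have "\<dots> = (\<integral>\<^sup>+s. (\<integral>\<^sup>+z. indicator {?y..} s * indicator {?z..} z \<partial>Z n) \<partial>S n)"
    proof -
      have [simp]: "{?y..} \<in> sets (S n)" "{?z..} \<in> sets (Z n)"
        by (simp_all add: sets')
      have "(\<integral>\<^sup>+z. indicator {?y..} s * indicator {?z..} z \<partial>Z n) = emeasure (Z n) {?z..} * indicator {?y..} s" for s
        by (subst nn_integral_cmult_indicator) (auto simp: mult.commute)
      then show ?thesis
        by (simp only:) (subst nn_integral_cmult_indicator, simp, rule mult.commute)
    qed
    also have "\<dots> \<le> (\<integral>\<^sup>+s. (\<integral>\<^sup>+z. indicator {w..} (?k * (s * z)) \<partial>Z n) \<partial>S n)"
    proof (intro nn_integral_mono)
      fix s t :: real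
      have "w \<le> ?k * (s * t)" if "?y \<le> s" "?z \<le> t"
      proof -
        have "?k * (?y * ?z) \<le> ?k * (s * t)"
          using that yz by (intro mult_left_mono mult_mono) (auto simp: W_scale_def intro: order_trans[OF _ that(1)])
        then show ?thesis by (simp only: k)
      qed
      then show "(indicator {?y..} s * indicator {?z..} t :: ennreal) \<le> indicator {w..} (?k * (s * t))"
        by (auto simp: indicator_def)
    qed
    also have "\<dots> = (\<integral>\<^sup>+v. indicator {w..} v \<partial>P n)"
      by (rule P[OF elim(3), symmetric]) simp
    also have "\<dots> = emeasure (P n) {w..}"
      using sets' by simp
    finally show ?case .
  qed
qed

text \<open>The mass beyond v is subtracted from the tail at w. The rate is strictly increasing, so
  the subtracted part is exponentially smaller.\<close>

lemma product_interval_lower: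
  fixes P :: "nat \<Rightarrow> real measure"
  assumes r: "r > 0"
    and sets: "\<And>n. n \<ge> 1 \<Longrightarrow> sets (P n) = sets borel"
    and upper: "\<And>t h. t > 0 \<Longrightarrow> h > 0 \<Longrightarrow> \<forall>\<^sub>F n in sequentially. emeasure (P n) {w. t \<le> \<bar>w\<bar>}
      \<le> ennreal (exp (- (n powr r * (t powr r / r - h))))"
    and lower: "\<And>w h. w > 0 \<Longrightarrow> h > 0 \<Longrightarrow> \<forall>\<^sub>F n in sequentially.
      ennreal (exp (- (n powr r * (w powr r / r + h)))) \<le> emeasure (P n) {w..}"
    and w: "0 < w" "w < v" and h: "h > 0"
  shows "\<forall>\<^sub>F n in sequentially.
      ennreal (exp (- (n powr r * (w powr r / r + h)))) \<le> emeasure (P n) {w..<v}"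
proof -
  define A B where "A = w powr r / r" and "B = v powr r / r"
  have AB: "A < B" unfolding A_def B_def using w r by (intro divide_strict_right_mono powr_less_mono2) auto
  have v: "v > 0" using w by simp
  \<comment> \<open>With 4 d <= B - A the tail at v is at most exp (- N (A + 3 d)), N being the
    speed, while the tail at w is at least exp (- N (A + d)). The difference still exceeds exp (- N
    (A + 2 d)), and 2 d <= h.\<close>
  define d where "d = min (h / 2) ((B - A) / 4)"
  have d: "d > 0" "A + 2 * d \<le> A + h" "A + 3 * d \<le> B - d"
  proof -
    have "d \<le> h / 2" "d \<le> (B - A) / 4" unfolding d_def by (rule min.cobounded1, rule min.cobounded2)
    then show "A + 2 * d \<le> A + h" "A + 3 * d \<le> B - d" by simp_all
    show "d > 0" using AB h by (simp add: d_def)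
  qed
  have "\<forall>\<^sub>F n in sequentially. exp (- (2 * d) * real n powr r) + exp (- d * real n powr r) \<le> 1"
    using r d by real_asymp
  then show ?thesis
    using upper[OF v d(1)] lower[OF w(1) d(1)] eventually_ge_at_top[of 1]
  proof eventually_elim
    case (elim n)
    let ?N = "real n powr r"
    have s: "{w..<v} \<in> sets (P n)" "{w. v \<le> \<bar>w\<bar>} \<in> sets (P n)" "{w..} \<in> sets (P n)"
      using sets[OF elim(4)] by auto
    have "exp (- (?N * (A + h))) + exp (- (?N * (B - d))) \<le> exp (- (?N * (A + 2 * d))) + exp (- (?N * (A + 3 * d)))"
      using d by (intro add_mono) (auto intro!: mult_left_mono)
    also have "\<dots> = exp (- (?N * (A + d))) * (exp (- (2 * d) * ?N) + exp (- d * ?N))"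
      unfolding distrib_left exp_add[symmetric] by (simp add: algebra_simps)
    also have "\<dots> \<le> exp (- (?N * (A + d))) * 1"
      by (intro mult_left_mono elim) auto
    finally have "ennreal (exp (- (?N * (A + h)))) + ennreal (exp (- (?N * (B - d)))) \<le> ennreal (exp (- (?N * (A + d))))"
      by (simp add: ennreal_leI flip: ennreal_plus)
    also have "\<dots> \<le> emeasure (P n) {w..}"
      using elim(3) by (simp add: A_def)
    also have "\<dots> \<le> emeasure (P n) ({w..<v} \<union> {w. v \<le> \<bar>w\<bar>})"
      using s by (intro emeasure_mono) auto
    also have "\<dots> \<le> emeasure (P n) {w..<v} + emeasure (P n) {w. v \<le> \<bar>w\<bar>}"
      using s by (intro emeasure_subadditive) auto
    also have "\<dots> \<le> emeasure (P n) {w..<v} + ennreal (exp (- (?N * (B - d))))"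
      using elim(2) by (intro add_left_mono) (simp add: B_def)
    finally show ?case
      by (simp add: A_def ennreal_add_left_cancel_le add.commute)
  qed
qed

section \<open>The law of the projection and its deviations\<close>

lemma measurable_projection_W [measurable]:
  "(\<lambda>(x, \<theta>). projection_W n p x \<theta>) \<in> borel_measurable (borel_Rn n \<Otimes>\<^sub>M borel_Rn n)"
  unfolding projection_W_def split_beta by measurable

text \<open>The sign \<open>c\<close> records that the law of the projection is symmetric.\<close>

lemma projection_W_law:
  assumes n: "n \<ge> 1" and M: "prob_space M"
    and X: "distr M (borel_Rn n) X = \<mu>"
    and \<sigma>: "rotation_invariant_sphere_prob n (distr M (borel_Rn n) \<Theta>)"
    and ind: "prob_space.indep_var M (borel_Rn n) X (borel_Rn n) \<Theta>"
    and c: "\<bar>c\<bar> = 1" and f [measurable]: "f \<in> borel_measurable borel"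
  shows "(\<integral>\<^sup>+w. f w \<partial>distr M borel (\<lambda>\<omega>. c * projection_W n p (X \<omega>) (\<Theta> \<omega>)))
       = (\<integral>\<^sup>+s. (\<integral>\<^sup>+z. f (W_scale n p * (s * z)) \<partial>distr (distr M (borel_Rn n) \<Theta>) borel (\<lambda>\<theta>. \<theta> 1)) \<partial>distr \<mu> borel (norm_Rn n))"
proof -
  interpret prob_space M by fact
  have rv [measurable]: "X \<in> measurable M (borel_Rn n)" "\<Theta> \<in> measurable M (borel_Rn n)"
    and joint: "distr M (borel_Rn n) X \<Otimes>\<^sub>M distr M (borel_Rn n) \<Theta>
      = distr M (borel_Rn n \<Otimes>\<^sub>M borel_Rn n) (\<lambda>x. (X x, \<Theta> x))"
    using ind by (auto simp: indep_var_distribution_eq)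
  let ?\<sigma> = "distr M (borel_Rn n) \<Theta>"
  interpret s: prob_space ?\<sigma> by (rule prob_space_distr) (rule rv)
  let ?k = "W_scale n p"
  have one [measurable]: "(\<lambda>\<theta>. \<theta> 1) \<in> borel_measurable (borel_Rn n)"
    using n by (intro measurable_component_singleton) simp
  have F: "(\<lambda>(x, \<theta>). f (c * projection_W n p x \<theta>)) \<in> borel_measurable (borel_Rn n \<Otimes>\<^sub>M borel_Rn n)"
    using measurable_projection_W[of n p] by (simp add: split_beta)
  have "(\<integral>\<^sup>+w. f w \<partial>distr M borel (\<lambda>\<omega>. c * projection_W n p (X \<omega>) (\<Theta> \<omega>)))
      = (\<integral>\<^sup>+\<omega>. f (c * projection_W n p (X \<omega>) (\<Theta> \<omega>)) \<partial>M)"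
  proof (rule nn_integral_distr)
    show "(\<lambda>\<omega>. c * projection_W n p (X \<omega>) (\<Theta> \<omega>)) \<in> borel_measurable M"
      using measurable_compose[OF measurable_Pair[OF rv] measurable_projection_W] by simp
  qed simp
  also have "\<dots> = (\<integral>\<^sup>+y. (\<lambda>(x, \<theta>). f (c * projection_W n p x \<theta>)) y \<partial>distr M (borel_Rn n \<Otimes>\<^sub>M borel_Rn n) (\<lambda>x. (X x, \<Theta> x)))"
    by (subst nn_integral_distr[OF measurable_Pair[OF rv]]) (simp_all only: measurable_distr_eq1 F split_conv)
  also have "\<dots> = (\<integral>\<^sup>+x. (\<integral>\<^sup>+\<theta>. f (c * projection_W n p x \<theta>) \<partial>?\<sigma>) \<partial>\<mu>)"
  proof -
    have "(\<lambda>(x, \<theta>). f (c * projection_W n p x \<theta>)) \<in> borel_measurable (\<mu> \<Otimes>\<^sub>M ?\<sigma>)"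
      using F X by (subst measurable_cong_sets[OF sets_pair_measure_cong refl]) auto
    from s.nn_integral_fst[OF this] show ?thesis
      unfolding joint[symmetric] X by simp
  qed
  also have "\<dots> = (\<integral>\<^sup>+x. (\<integral>\<^sup>+\<theta>. f (?k * (norm_Rn n x * \<theta> 1)) \<partial>?\<sigma>) \<partial>\<mu>)"
  proof (rule nn_integral_cong)
    fix x
    \<comment> \<open>The sign is moved onto x, where the Euclidean norm forgets it.\<close>
    have "c * projection_W n p x \<theta> = ?k * (\<Sum>i=1..n. (c * x i) * \<theta> i)" for \<theta>
      by (simp add: projection_W_def W_scale_def sum_distrib_left mult_ac)
    then have "(\<integral>\<^sup>+\<theta>. f (c * projection_W n p x \<theta>) \<partial>?\<sigma>) = (\<integral>\<^sup>+\<theta>. f (?k * (\<Sum>i=1..n. (c * x i) * \<theta> i)) \<partial>?\<sigma>)"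
      by simp
    also have "\<dots> = (\<integral>\<^sup>+\<theta>. f (?k * (norm_Rn n (\<lambda>i. c * x i) * \<theta> 1)) \<partial>?\<sigma>)"
      by (rule nn_integral_sphere_inner[OF \<sigma> n, of "\<lambda>t. f (?k * t)"]) measurable
    also have "norm_Rn n (\<lambda>i. c * x i) = norm_Rn n x"
    proof -
      have "c\<^sup>2 = 1" using c by (metis power2_abs power_one)
      then show ?thesis by (simp add: norm_Rn_def power_mult_distrib)
    qed
    finally show "(\<integral>\<^sup>+\<theta>. f (c * projection_W n p x \<theta>) \<partial>?\<sigma>) = (\<integral>\<^sup>+\<theta>. f (?k * (norm_Rn n x * \<theta> 1)) \<partial>?\<sigma>)" .
  qed
  also have "\<dots> = (\<integral>\<^sup>+x. (\<integral>\<^sup>+z. f (?k * (norm_Rn n x * z)) \<partial>distr ?\<sigma> borel (\<lambda>\<theta>. \<theta> 1)) \<partial>\<mu>)"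
  proof (intro nn_integral_cong)
    fix x
    show "(\<integral>\<^sup>+\<theta>. f (?k * (norm_Rn n x * \<theta> 1)) \<partial>?\<sigma>) = (\<integral>\<^sup>+z. f (?k * (norm_Rn n x * z)) \<partial>distr ?\<sigma> borel (\<lambda>\<theta>. \<theta> 1))"
      by (rule nn_integral_distr[symmetric]) (use one in \<open>simp_all only: measurable_distr_eq1\<close>, measurable)
  qed
  also have "\<dots> = (\<integral>\<^sup>+s. (\<integral>\<^sup>+z. f (?k * (s * z)) \<partial>distr ?\<sigma> borel (\<lambda>\<theta>. \<theta> 1)) \<partial>distr \<mu> borel (norm_Rn n))"
  proof -
    interpret z: prob_space "distr ?\<sigma> borel (\<lambda>\<theta>. \<theta> 1)"
      by (rule s.prob_space_distr) (use one in \<open>simp only: measurable_distr_eq1\<close>)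
    have "(\<lambda>s. \<integral>\<^sup>+z. f (?k * (s * z)) \<partial>distr ?\<sigma> borel (\<lambda>\<theta>. \<theta> 1)) \<in> borel_measurable borel"
      by measurable
    then show ?thesis
      using X by (intro nn_integral_distr[symmetric]) (auto simp del: One_nat_def)
  qed
  finally show ?thesis .
qed

text \<open>Taking c = 1 and c = -1 gives interval bounds on both sides of the origin from estimates
  stated for positive w only.\<close>

lemma projection_W_deviations:
  fixes M :: "nat \<Rightarrow> 'a measure" and X \<Theta> :: "nat \<Rightarrow> 'a \<Rightarrow> (nat \<Rightarrow> real)"
  assumes p: "1 \<le> p" "p < 2"
    and prob: "\<And>n. n \<ge> 1 \<Longrightarrow> prob_space (M n)"
    and X: "\<And>n. n \<ge> 1 \<Longrightarrow> distr (M n) (borel_Rn n) (X n) = uniform_measure (lebesgue_Rn n) (lp_ball n p)"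
    and \<Theta>: "\<And>n. n \<ge> 1 \<Longrightarrow> rotation_invariant_sphere_prob n (distr (M n) (borel_Rn n) (\<Theta> n))"
    and indep: "\<And>n. n \<ge> 1 \<Longrightarrow> prob_space.indep_var (M n) (borel_Rn n) (X n) (borel_Rn n) (\<Theta> n)"
    and c: "\<bar>c\<bar> = 1"
  defines "P \<equiv> \<lambda>n. distr (M n) borel (\<lambda>\<omega>. c * projection_W n p (X n \<omega>) (\<Theta> n \<omega>))"
  shows projection_W_tail_upper:
      "\<And>t h. t > 0 \<Longrightarrow> h > 0 \<Longrightarrow> \<forall>\<^sub>F n in sequentially. emeasure (P n) {w. t \<le> \<bar>w\<bar>}
        \<le> ennreal (exp (- (n powr r_exp p * (t powr r_exp p / r_exp p - h))))"
    and projection_W_interval_lower: "\<And>w v h. 0 < w \<Longrightarrow> w < v \<Longrightarrow> h > 0 \<Longrightarrow> \<forall>\<^sub>F n in sequentially.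
        ennreal (exp (- (n powr r_exp p * (w powr r_exp p / r_exp p + h)))) \<le> emeasure (P n) {w..<v}"
proof -
  define S where "S n = distr (uniform_measure (lebesgue_Rn n) (lp_ball n p)) borel (norm_Rn n)" for n
  define Z where "Z n = distr (distr (M n) (borel_Rn n) (\<Theta> n)) borel (\<lambda>\<theta>. \<theta> 1)" for n
  define T where "T n = distr (PiM {1..n} (\<lambda>_. pgauss p)) borel (norm_Rn n)" for n
  note r = r_exp_props[OF p]
  have sets: "sets (S n) = sets borel" "sets (Z n) = sets borel" "sets (P n) = sets borel" for n
    by (simp_all add: S_def Z_def P_def)
  have law: "(\<integral>\<^sup>+w. f w \<partial>P n) = (\<integral>\<^sup>+s. (\<integral>\<^sup>+z. f (W_scale n p * (s * z)) \<partial>Z n) \<partial>S n)"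
    if "n \<ge> 1" "f \<in> borel_measurable borel" for n f
    unfolding P_def S_def Z_def
    by (rule projection_W_law[OF that(1) prob X \<Theta> indep c that(2)]) (use that(1) in auto)
  have mixS: "radial_mixture n p (S n) (T n)" if n: "n \<ge> 1" for n
  proof -
    interpret prob_space "M n" by (rule prob[OF n])
    have "X n \<in> measurable (M n) (borel_Rn n)"
      using indep[OF n] by (auto simp: indep_var_distribution_eq)
    then have "prob_space (uniform_measure (lebesgue_Rn n) (lp_ball n p))"
      unfolding X[OF n, symmetric] by (rule prob_space_distr)
    then show ?thesis unfolding S_def T_def by (rule radial_mixture_lp_ball[OF p(1)])
  qed
  have mixZ: "radial_mixture n 2 (Z n) (pgauss 2)" if n: "n \<ge> 1" for n
    unfolding Z_def by (rule radial_mixture_sphere[OF \<Theta>[OF n] n])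
  have S_upper: "\<exists>C. \<forall>\<^sub>F n in sequentially.
      (\<integral>\<^sup>+s. ennreal (exp ((1 - e)\<^sup>2 * n * (\<bar>s\<bar> powr p / p))) \<partial>S n) \<le> ennreal (2 * exp (C * n powr (p / 2)))"
    if e: "0 < e" "e \<le> 1" for e :: real
  proof -
    obtain C where C: "\<And>n. n \<ge> 1 \<Longrightarrow>
        (\<integral>\<^sup>+y. ennreal (exp ((1 - e) / p * norm_Rn n y powr p)) \<partial>PiM {1..n} (\<lambda>_. pgauss p)) \<le> ennreal (exp (C * n powr (p / 2)))"
      using pgauss_norm_exp_moment[OF p e] by blast
    have "(\<integral>\<^sup>+t. ennreal (exp ((1 - e) / p * \<bar>t\<bar> powr p)) \<partial>T n) \<le> ennreal (exp (C * n powr (p / 2)))" if "n \<ge> 1" for n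
      unfolding T_def using C[OF that] by (subst nn_integral_distr) (auto simp del: One_nat_def)
    from radial_mixture_exp_moment_eventually[OF mixS p(1) e this] show ?thesis by blast
  qed
  have Z_upper: "\<exists>C. \<forall>\<^sub>F n in sequentially.
      (\<integral>\<^sup>+z. ennreal (exp ((1 - e)\<^sup>2 * n * (\<bar>z\<bar> powr 2 / 2))) \<partial>Z n) \<le> ennreal (2 * exp C)"
    if e: "0 < e" "e \<le> 1" for e :: real
  proof -
    \<comment> \<open>The Gaussian moment equals \<open>e powr (- (1 / 2))\<close> for every n, so
      the growth exponent in the transfer of moments is 0, with \<open>n powr 0 = 1\<close> for n >=
      1.\<close>
    define C where "C = ln (e powr (- (1 / 2)))"
    have C: "exp C = e powr (- (1 / 2))" and eq: "1 - (1 - e) / 2 * 2 = e"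
      using e by (simp add: C_def del: ln_powr, simp add: field_simps)
    have "(\<integral>\<^sup>+t. ennreal (exp ((1 - e) / 2 * \<bar>t\<bar> powr 2)) \<partial>pgauss 2) \<le> ennreal (exp (C * n powr 0))" if "n \<ge> 1" for n :: nat
      using pgauss_mgf[of 2 "(1 - e) / 2", unfolded eq] e that C by simp
    from radial_mixture_exp_moment_eventually[OF mixZ _ e this]
    have "\<forall>\<^sub>F n in sequentially. (\<integral>\<^sup>+z. ennreal (exp ((1 - e)\<^sup>2 * n * (\<bar>z\<bar> powr 2 / 2))) \<partial>Z n) \<le> ennreal (2 * exp (C * real n powr 0))"
      by simp
    then have "\<forall>\<^sub>F n in sequentially. (\<integral>\<^sup>+z. ennreal (exp ((1 - e)\<^sup>2 * n * (\<bar>z\<bar> powr 2 / 2))) \<partial>Z n) \<le> ennreal (2 * exp C)"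
      using eventually_ge_at_top[of 1] by eventually_elim simp
    then show ?thesis by blast
  qed
  have S_lower: "\<forall>\<^sub>F n in sequentially.
      ennreal (exp (- (n powr r_exp p * (y powr p / p + h)))) \<le> emeasure (S n) {y * n powr ((r_exp p - 1) / p)..}"
    if "y > 0" "h > 0" for y h
  proof (rule radial_mixture_tail_eventually[OF mixS p(1) pgauss_const(2)[OF p(1)] r(1,2) that])
    fix n :: nat and x :: real
    assume n: "n \<ge> 1" and x: "x \<ge> 0"
    let ?G = "PiM {1..n} (\<lambda>_. pgauss p)"
    have 1: "1 \<in> {1..n}" using n by simp
    have m: "(\<lambda>y. y 1) \<in> measurable ?G (pgauss p)"
      by (rule measurable_component_singleton[OF 1])
    have "ennreal (exp (- ((x + 1) powr p / p)) / pgauss_const p) \<le> emeasure (pgauss p) {x..}"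
      by (rule pgauss_tail_lower[OF p(1) x])
    also have "\<dots> = emeasure (distr ?G (pgauss p) (\<lambda>y. y 1)) {x..}"
      using 1 p by (subst distr_PiM_component) (auto intro: prob_space_pgauss)
    also have "\<dots> = emeasure ?G ((\<lambda>y. y 1) -` {x..} \<inter> space ?G)"
      by (rule emeasure_distr[OF m]) simp
    \<comment> \<open>The norm dominates the first coordinate, so the one-dimensional tail gives a
      bound that is uniform in n.\<close>
    also have "\<dots> \<le> emeasure ?G (norm_Rn n -` {x..} \<inter> space ?G)"
    proof (rule emeasure_mono)
      show "(\<lambda>y. y 1) -` {x..} \<inter> space ?G \<subseteq> norm_Rn n -` {x..} \<inter> space ?G"
      proof
        fix y :: "nat \<Rightarrow> real"
        assume "y \<in> (\<lambda>y. y 1) -` {x..} \<inter> space ?G"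
        then have y: "x \<le> y 1" "y \<in> space ?G" by auto
        have "(y 1)\<^sup>2 \<le> (\<Sum>i=1..n. (y i)\<^sup>2)"
          using 1 by (intro member_le_sum) auto
        then have "\<bar>y 1\<bar> \<le> norm_Rn n y"
          unfolding norm_Rn_def by (intro real_le_rsqrt) simp
        then have "x \<le> norm_Rn n y" using y(1) by linarith
        then show "y \<in> norm_Rn n -` {x..} \<inter> space ?G" using y(2) by blast
      qed
      have "norm_Rn n \<in> borel_measurable ?G" by measurable
      then show "norm_Rn n -` {x..} \<inter> space ?G \<in> sets ?G" by (rule measurable_sets) simp
    qed
    also have "\<dots> = emeasure (T n) {x..}"
      unfolding T_def by (subst emeasure_distr) (simp_all del: One_nat_def)
    finally show "ennreal (exp (- ((x + 1) powr p / p)) / pgauss_const p) \<le> emeasure (T n) {x..}" .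
  qed
  have Z_lower: "\<forall>\<^sub>F n in sequentially.
      ennreal (exp (- (n powr r_exp p * (y powr 2 / 2 + h)))) \<le> emeasure (Z n) {y * n powr ((r_exp p - 1) / 2)..}"
    if "y > 0" "h > 0" for y h
    by (rule radial_mixture_tail_eventually[OF mixZ _ pgauss_const(2) r(1,2) that pgauss_tail_lower]) auto
  show upper: "\<forall>\<^sub>F n in sequentially. emeasure (P n) {w. t \<le> \<bar>w\<bar>}
        \<le> ennreal (exp (- (n powr r_exp p * (t powr r_exp p / r_exp p - h))))" if "t > 0" "h > 0" for t h
    by (rule product_tail_upper[OF p sets law S_upper Z_upper that])
  have lower: "\<forall>\<^sub>F n in sequentially.
      ennreal (exp (- (n powr r_exp p * (w powr r_exp p / r_exp p + h)))) \<le> emeasure (P n) {w..}"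
    if "w > 0" "h > 0" for w h
    by (rule product_tail_lower[OF p sets law S_lower Z_lower that])
  show "\<forall>\<^sub>F n in sequentially.
        ennreal (exp (- (n powr r_exp p * (w powr r_exp p / r_exp p + h)))) \<le> emeasure (P n) {w..<v}"
    if "0 < w" "w < v" "h > 0" for w v h
    by (rule product_interval_lower[OF r(1) sets(3) upper lower that])
qed

section \<open>The large deviation principle\<close>

lemma elog_mono: "0 \<le> x \<Longrightarrow> x \<le> y \<Longrightarrow> elog x \<le> elog y"
  by (auto simp: elog_def)

lemma elog_upper:
  assumes "s > 0" "0 \<le> x" "x \<le> exp (- (s * A))"
  shows "ereal (1 / s) * elog x \<le> ereal (- A)"
proof (cases "x = 0")
  case False
  then have "ln x \<le> - (s * A)"
    using assms by (metis antisym_conv exp_gt_zero ln_exp ln_le_cancel_iff not_le)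
  then show ?thesis
    using False assms by (simp add: elog_def field_simps)
qed (use assms in \<open>simp add: elog_def\<close>)

lemma elog_lower:
  assumes "s > 0" "exp (- (s * A)) \<le> x"
  shows "ereal (- A) \<le> ereal (1 / s) * elog x"
proof -
  have x: "x > 0" using assms(2) by (meson exp_gt_zero less_le_trans)
  then have "- (s * A) \<le> ln x"
    using assms(2) by (metis exp_gt_zero ln_exp ln_le_cancel_iff)
  then show ?thesis
    using x assms by (simp add: elog_def field_simps)
qed

section \<open>The rate function and the reduction of the principle to tails and intervals\<close>

lemma continuous_annealed_rate:
  assumes "r_exp p > 0"
  shows "((\<lambda>w. annealed_rate p w) \<longlongrightarrow> annealed_rate p x) (nhds x)"
proof -
  have "((\<lambda>w::real. \<bar>w\<bar> powr r_exp p) \<longlongrightarrow> \<bar>x\<bar> powr r_exp p) (nhds x)"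
    using assms by (intro tendsto_powr' tendsto_rabs tendsto_const) (auto simp: filterlim_def)
  then show ?thesis
    unfolding annealed_rate_def by (intro tendsto_ereal tendsto_mult_left)
qed

text \<open>For r < 1 the rate is not convex, but its sublevel sets are centred intervals, which
  yields goodness and quasiconvexity together. Negative c is split off because \<open>powr\<close>
  of a negative base would still give a positive radius.\<close>

lemma annealed_rate_sublevel:
  assumes "r_exp p > 0"
  shows "{w. annealed_rate p w \<le> ereal c} = (if c < 0 then {} else cball 0 ((c * r_exp p) powr (1 / r_exp p)))"
proof -
  define r where "r = r_exp p"
  have r: "r > 0" using assms by (simp add: r_def)
  have "annealed_rate p w \<le> ereal c \<longleftrightarrow> \<bar>w\<bar> \<le> (c * r) powr (1 / r)" if "c \<ge> 0" for w
  proof -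
    have "annealed_rate p w \<le> ereal c \<longleftrightarrow> \<bar>w\<bar> powr r \<le> c * r"
      using r by (simp add: annealed_rate_def r_def[symmetric] field_simps)
    also have "c * r = ((c * r) powr (1 / r)) powr r"
      using that r by (cases "c = 0") (auto simp: powr_powr)
    also have "\<bar>w\<bar> powr r \<le> \<dots> \<longleftrightarrow> \<bar>w\<bar> \<le> (c * r) powr (1 / r)"
      using r powr_mono2[of r "\<bar>w\<bar>" "(c * r) powr (1 / r)"] powr_less_mono2[of r "(c * r) powr (1 / r)" "\<bar>w\<bar>"]
      by (force simp: not_le)
    finally show ?thesis .
  qed
  moreover have "\<not> annealed_rate p w \<le> ereal c" if "c < 0" for w
  proof -
    have "0 \<le> 1 / r * \<bar>w\<bar> powr r" using r by simp
    then show ?thesis using that by (simp add: annealed_rate_def r_def[symmetric] not_le)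
  qed
  ultimately show ?thesis
    by (auto simp: r_def[symmetric] not_less)
qed

lemma annealed_rate_props:
  assumes r: "r_exp p > 0"
  shows "good_rate_function (annealed_rate p)" "quasiconvex (annealed_rate p)" "symmetric_fun (annealed_rate p)"
proof -
  have "lower_semicontinuous (annealed_rate p)"
    unfolding lower_semicontinuous_def
    using order_tendstoD(1)[OF continuous_annealed_rate[OF r]] by blast
  moreover have "0 \<le> annealed_rate p x" for x
    using r by (simp add: annealed_rate_def)
  ultimately show "good_rate_function (annealed_rate p)"
    unfolding good_rate_function_def rate_function_def annealed_rate_sublevel[OF r] by auto
  show "quasiconvex (annealed_rate p)"
    unfolding quasiconvex_def annealed_rate_sublevel[OF r] by auto
  show "symmetric_fun (annealed_rate p)"
    by (simp add: symmetric_fun_def annealed_rate_def)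
qed

text \<open>A closed set missing the origin lies in the tail given by its point nearest to 0, and
  that point also attains the infimum of the rate. An open set around x contains an interval just
  beyond \<bar>x\<bar> on the side of x.\<close>

lemma satisfies_LDP_annealed_rateI:
  fixes M :: "nat \<Rightarrow> 'a measure" and W :: "nat \<Rightarrow> 'a \<Rightarrow> real"
  assumes r: "r_exp p > 0"
    and prob: "\<And>n. n \<ge> 1 \<Longrightarrow> prob_space (M n)"
    and W: "\<And>n. n \<ge> 1 \<Longrightarrow> W n \<in> borel_measurable (M n)"
    and upper: "\<And>t h. t > 0 \<Longrightarrow> h > 0 \<Longrightarrow> \<forall>\<^sub>F n in sequentially.
        measure (M n) {\<omega> \<in> space (M n). t \<le> \<bar>W n \<omega>\<bar>} \<le> exp (- (n powr r_exp p * (t powr r_exp p / r_exp p - h)))"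
    and lower: "\<And>c w v h. \<bar>c\<bar> = 1 \<Longrightarrow> 0 < w \<Longrightarrow> w < v \<Longrightarrow> h > 0 \<Longrightarrow> \<forall>\<^sub>F n in sequentially.
        exp (- (n powr r_exp p * (w powr r_exp p / r_exp p + h))) \<le> measure (M n) {\<omega> \<in> space (M n). c * W n \<omega> \<in> {w..<v}}"
  shows "satisfies_LDP M W (\<lambda>n. real n powr r_exp p) (annealed_rate p)"
proof -
  define r where "r = r_exp p"
  have r0: "r > 0" using r by (simp add: r_def)
  define L where "L A n = ereal (1 / real n powr r) * elog (measure (M n) {\<omega> \<in> space (M n). W n \<omega> \<in> A})" for A n
  have mono: "\<forall>\<^sub>F n in sequentially. measure (M n) {\<omega> \<in> space (M n). W n \<omega> \<in> A} \<le> measure (M n) {\<omega> \<in> space (M n). W n \<omega> \<in> B}"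
    if "A \<subseteq> B" "B \<in> sets borel" for A B
    using eventually_ge_at_top[of 1]
  proof eventually_elim
    case (elim n)
    interpret prob_space "M n" by (rule prob[OF elim])
    have "{\<omega> \<in> space (M n). W n \<omega> \<in> B} \<in> sets (M n)"
      using measurable_sets[OF W[OF elim] that(2)] by (simp add: vimage_def Int_def conj_commute)
    then show ?case using that by (intro finite_measure_mono) auto
  qed
  have low: "- annealed_rate p x \<le> liminf (L G)" if G: "open G" "x \<in> G" for G x
  proof (rule ereal_le_epsilon2)
    fix h :: real assume h: "h > 0"
    obtain d where d: "d > 0" "ball x d \<subseteq> G"
      using G openE by blast
    define c where "c = (if x \<ge> 0 then 1 else - 1 :: real)"
    have c: "\<bar>c\<bar> = 1" "c * \<bar>x\<bar> = x" by (auto simp: c_def)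
    define A B where "A = \<bar>x\<bar> powr r" and "B = (\<bar>x\<bar> + d) powr r"
    have A: "A \<ge> 0" "A < B" using d r0 by (auto simp: A_def B_def intro!: powr_less_mono2)
    \<comment> \<open>The interval starts at w = m^(1/r), strictly beyond \<bar>x\<bar>, so that w >
      0 even for x = 0. Its rate exceeds that of x by at most h / 2, and w stays below \<bar>x\<bar>
      + d.\<close>
    define m where "m = min (A + r * (h / 2)) ((A + B) / 2)"
    have m: "A < m" "m < B" "m \<le> A + r * (h / 2)"
      using A h r0 by (auto simp: m_def min_less_iff_disj)
    define w where "w = m powr (1 / r)"
    have wr: "w powr r = m" using m A r0 by (simp add: w_def powr_powr)
    have w0: "w > 0" using m A by (simp add: w_def)
    have w1: "\<bar>x\<bar> < w"
      using m(1) powr_mono2[of r w "\<bar>x\<bar>"] r0 w0 unfolding wr[symmetric] A_def by linarith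
    have w2: "w < \<bar>x\<bar> + d"
      using m(2) powr_mono2[of r "\<bar>x\<bar> + d" w] r0 d unfolding wr[symmetric] B_def by linarith
    have sub: "{v. c * v \<in> {w..<\<bar>x\<bar> + d}} \<subseteq> G"
    proof
      fix v assume "v \<in> {v. c * v \<in> {w..<\<bar>x\<bar> + d}}"
      then have "\<bar>c * v - \<bar>x\<bar>\<bar> < d" using w1 by auto
      then have "\<bar>v - x\<bar> < d" using c(2) by (auto simp: c_def split: if_splits)
      then show "v \<in> G" using d by (auto simp: dist_real_def)
    qed
    have "\<forall>\<^sub>F n in sequentially. ereal (- (m / r + h / 2)) \<le> L G n"
      using lower[OF c(1) w0 w2 half_gt_zero[OF h]] mono[OF sub borel_open[OF G(1)]] eventually_gt_at_top[of 0]
    proof eventually_elim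
      case (elim n)
      then show ?case
        unfolding L_def using G(1) wr r0 by (intro elog_lower) (auto simp: r_def)
    qed
    then have "ereal (- (m / r + h / 2)) \<le> liminf (L G)"
      by (rule Liminf_bounded)
    moreover have "- annealed_rate p x \<le> ereal (- (m / r + h / 2)) + ereal h"
      using m(3) r0 by (simp add: annealed_rate_def r_def[symmetric] A_def field_simps)
    ultimately show "- annealed_rate p x \<le> liminf (L G) + ereal h"
      by (meson add_right_mono order_trans)
  qed
  have up: "limsup (L F) \<le> - (INF x\<in>F. annealed_rate p x)" if F: "closed F" for F
  proof -
    consider "F = {}" | "0 \<in> F" | "F \<noteq> {}" "0 \<notin> F" by blast
    then show ?thesis
    proof cases
      case 1
      \<comment> \<open>The index 0 is left out: there the prefactor 1 / 0 is 0, and its product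
        with minus infinity would be 0.\<close>
      have "\<forall>\<^sub>F n in sequentially. L F n \<le> - \<infinity>"
        using eventually_gt_at_top[of 0] by eventually_elim (simp add: L_def 1 elog_def)
      then have "limsup (L F) \<le> - \<infinity>" by (rule Limsup_bounded)
      then show ?thesis by simp
    next
      case 2
      \<comment> \<open>The rate vanishes at the origin, so the trivial bound of a probability by 1
        is already sharp enough.\<close>
      have "\<forall>\<^sub>F n in sequentially. L F n \<le> ereal (- 0)"
        using eventually_gt_at_top[of 0]
      proof eventually_elim
        case (elim n)
        then interpret prob_space "M n" by (intro prob) simp
        show ?case unfolding L_def using elim by (intro elog_upper) auto
      qed
      then have "limsup (L F) \<le> ereal (- 0)" by (rule Limsup_bounded)
      also have "\<dots> \<le> - (INF x\<in>F. annealed_rate p x)"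
      proof -
        have "(INF x\<in>F. annealed_rate p x) \<le> annealed_rate p 0"
          by (rule INF_lower[OF 2])
        also have "\<dots> = 0" by (simp add: annealed_rate_def)
        finally show ?thesis by (simp flip: zero_ereal_def)
      qed
      finally show ?thesis .
    next
      case 3
      obtain y where y: "y \<in> F" "infdist 0 F = dist 0 y"
        using infdist_attains_inf[OF F 3(1), of 0] by blast
      define t where "t = \<bar>y\<bar>"
      have t: "t > 0" using y 3 by (auto simp: t_def)
      have sub: "F \<subseteq> {v. t \<le> \<bar>v\<bar>}"
        using infdist_le[of _ F 0] y by (auto simp: t_def dist_real_def)
      have "limsup (L F) \<le> ereal (- (t powr r / r))"
      proof (rule ereal_le_epsilon2)
        fix h :: real assume h: "h > 0"
        have cl: "{v::real. t \<le> \<bar>v\<bar>} \<in> sets borel" by measurable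
        have "\<forall>\<^sub>F n in sequentially. L F n \<le> ereal (- (t powr r / r - h))"
          using upper[OF t h] mono[OF sub cl] eventually_gt_at_top[of 0]
        proof eventually_elim
          case (elim n)
          then show ?case
            unfolding L_def by (intro elog_upper) (auto simp: r_def)
        qed
        then have "limsup (L F) \<le> ereal (- (t powr r / r - h))" by (rule Limsup_bounded)
        then show "limsup (L F) \<le> ereal (- (t powr r / r)) + ereal h" by simp
      qed
      also have "\<dots> \<le> - (INF x\<in>F. annealed_rate p x)"
      proof -
        have "(INF x\<in>F. annealed_rate p x) \<le> annealed_rate p y"
          by (rule INF_lower[OF y(1)])
        also have "\<dots> = ereal (t powr r / r)"
          by (simp add: annealed_rate_def t_def r_def)
        finally show ?thesis by (simp add: ereal_minus_le_minus flip: uminus_ereal.simps)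
      qed
      finally show ?thesis .
    qed
  qed
  have mid: "liminf (L (interior \<Gamma>)) \<le> limsup (L (closure \<Gamma>))" for \<Gamma>
  proof -
    have "\<forall>\<^sub>F n in sequentially. measure (M n) {\<omega> \<in> space (M n). W n \<omega> \<in> interior \<Gamma>} \<le> measure (M n) {\<omega> \<in> space (M n). W n \<omega> \<in> closure \<Gamma>}"
      using interior_subset[of \<Gamma>] closure_subset[of \<Gamma>] by (intro mono) auto
    then have "\<forall>\<^sub>F n in sequentially. L (interior \<Gamma>) n \<le> L (closure \<Gamma>) n"
      by eventually_elim (auto simp: L_def intro!: ereal_mult_left_mono elog_mono)
    then have "liminf (L (interior \<Gamma>)) \<le> liminf (L (closure \<Gamma>))"
      by (rule Liminf_mono)
    also have "\<dots> \<le> limsup (L (closure \<Gamma>))"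
      by (rule Liminf_le_Limsup) simp
    finally show ?thesis .
  qed
  have "- (INF x\<in>interior \<Gamma>. annealed_rate p x) \<le> liminf (L (interior \<Gamma>))" for \<Gamma>
  proof -
    have "- liminf (L (interior \<Gamma>)) \<le> (INF x\<in>interior \<Gamma>. annealed_rate p x)"
      using low[of "interior \<Gamma>"] by (intro INF_greatest) (auto simp: ereal_uminus_le_reorder)
    then show ?thesis by (simp add: ereal_uminus_le_reorder)
  qed
  then show ?thesis
    unfolding satisfies_LDP_def
    using prob W annealed_rate_props(1)[OF r] mid up
    by (auto simp: good_rate_function_def L_def[abs_def] r_def)
qed

theorem theorem2p3:
  fixes p :: real
    and M :: "nat \<Rightarrow> 'a measure"
    and X \<Theta> :: "nat \<Rightarrow> 'a \<Rightarrow> (nat \<Rightarrow> real)"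
  assumes p: "1 \<le> p" "p < 2"
    and prob: "\<And>n. n \<ge> 1 \<Longrightarrow> prob_space (M n)"
    and X_uniform: "\<And>n. n \<ge> 1 \<Longrightarrow>
          distr (M n) (borel_Rn n) (X n) = uniform_measure (lebesgue_Rn n) (lp_ball n p)"
    and Theta_rotation_invariant: "\<And>n. n \<ge> 1 \<Longrightarrow>
          rotation_invariant_sphere_prob n (distr (M n) (borel_Rn n) (\<Theta> n))"
    and indep: "\<And>n. n \<ge> 1 \<Longrightarrow>
          prob_space.indep_var (M n) (borel_Rn n) (X n) (borel_Rn n) (\<Theta> n)"
  shows "satisfies_LDP M (\<lambda>n \<omega>. projection_W n p (X n \<omega>) (\<Theta> n \<omega>))
           (\<lambda>n. real n powr r_exp p) (annealed_rate p)
       \<and> good_rate_function (annealed_rate p)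
       \<and> quasiconvex (annealed_rate p)
       \<and> symmetric_fun (annealed_rate p)"
proof (intro conjI)
  note r = r_exp_props(1)[OF p]
  let ?W = "\<lambda>n \<omega>. projection_W n p (X n \<omega>) (\<Theta> n \<omega>)"
  have W: "?W n \<in> borel_measurable (M n)" if n: "n \<ge> 1" for n
  proof -
    interpret prob_space "M n" by (rule prob[OF n])
    have "X n \<in> measurable (M n) (borel_Rn n)" "\<Theta> n \<in> measurable (M n) (borel_Rn n)"
      using indep[OF n] by (auto simp: indep_var_distribution_eq)
    from measurable_compose[OF measurable_Pair[OF this] measurable_projection_W] show ?thesis by simp
  qed
  have law: "emeasure (distr (M n) borel (\<lambda>\<omega>. c * ?W n \<omega>)) A = ennreal (measure (M n) {\<omega> \<in> space (M n). c * ?W n \<omega> \<in> A})"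
    if n: "n \<ge> 1" and A: "A \<in> sets borel" for n c A
  proof -
    interpret prob_space "M n" by (rule prob[OF n])
    show ?thesis
      using W[OF n] A by (subst emeasure_distr) (auto simp: emeasure_eq_measure vimage_def Int_def conj_commute)
  qed
  show "satisfies_LDP M ?W (\<lambda>n. real n powr r_exp p) (annealed_rate p)"
  proof (rule satisfies_LDP_annealed_rateI[OF r prob W])
    fix t h :: real assume th: "t > 0" "h > 0"
    have bound: "\<forall>\<^sub>F n in sequentially. emeasure (distr (M n) borel (\<lambda>\<omega>. 1 * ?W n \<omega>)) {w. t \<le> \<bar>w\<bar>}
        \<le> ennreal (exp (- (n powr r_exp p * (t powr r_exp p / r_exp p - h))))"
      by (rule projection_W_tail_upper[OF p prob X_uniform Theta_rotation_invariant indep abs_one th])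
    show "\<forall>\<^sub>F n in sequentially. measure (M n) {\<omega> \<in> space (M n). t \<le> \<bar>?W n \<omega>\<bar>}
        \<le> exp (- (n powr r_exp p * (t powr r_exp p / r_exp p - h)))"
      using bound eventually_ge_at_top[of 1]
    proof eventually_elim
      case (elim n)
      have "{w::real. t \<le> \<bar>w\<bar>} \<in> sets borel" by measurable
      then show ?case
        using elim law[OF elim(2), of "{w. t \<le> \<bar>w\<bar>}" 1] by (simp only: mult_1 mem_Collect_eq) simp
    qed
  next
    fix c w v h :: real assume c: "\<bar>c\<bar> = 1" and w: "0 < w" "w < v" "h > 0"
    have bound: "\<forall>\<^sub>F n in sequentially. ennreal (exp (- (n powr r_exp p * (w powr r_exp p / r_exp p + h))))
        \<le> emeasure (distr (M n) borel (\<lambda>\<omega>. c * ?W n \<omega>)) {w..<v}"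
      by (rule projection_W_interval_lower[OF p prob X_uniform Theta_rotation_invariant indep c w])
    show "\<forall>\<^sub>F n in sequentially. exp (- (n powr r_exp p * (w powr r_exp p / r_exp p + h)))
        \<le> measure (M n) {\<omega> \<in> space (M n). c * ?W n \<omega> \<in> {w..<v}}"
      using bound eventually_ge_at_top[of 1]
    proof eventually_elim
      case (elim n)
      then show ?case
        using law[OF elim(2), of "{w..<v}" c] by (simp add: ennreal_le_iff)
    qed
  qed auto
qed (rule annealed_rate_props[OF r_exp_props(1)[OF p]])+

end
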